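(* Let $X$ be a metrizable space and $G$ an abelian group. Then $$d^{f}_{\infty}(X;G)=d_{f}(\beta X\setminus X;G).$$
   Context: Conventions. Normal spaces are $T_1$ (hence Hausdorff). $\beta X$ is the Stone–Čech compactification. A closed pair $(X,A)$ is a space $X$ with a closed subset $A$; a single space $X$ is identified with $(X,\emptyset)$, in which case the distinguished index set below is taken empty. An indexed family $\alpha=\{\alpha_v\}_{v\in V_\alpha}$ is a function $v\mapsto\alpha_v$ from an index set $V_\alpha$ to subsets; it is finite if $V_\alpha$ is finite. Border cohomology of a space. A border cover of a normal space $X$ is a finite indexed family $\alpha=\{\alpha_v\}_{v\in V_\alpha}$ of open subsets of $X$ such that $X\setminus\bigcup_{v\in V_\alpha}\alpha_v$ is compact. The set $\mathrm{cov}_\infty(X)$ of border covers is directed by $\alpha\le\beta$ iff there is a refinement projection $p:V_\beta\to V_\alpha$ with $\beta_v\subseteq\alpha_{p(v)}$ for all $v\in V_\beta$. The nerve $X_\alpha$ is the simplicial complex whose simplexes are the nonempty finite $s\subseteq V_\alpha$ with $\bigcap_{v\in s}\alpha_v\ne\emptyset$. Refinement projections induce simplicial maps $X_\beta\to X_\alpha$, any two contiguous, hence well-defined homomorphisms $H^n(X_\alpha;G)\to H^n(X_\beta;G)$. Put $\hat H^n_\infty(X;G)=\varinjlim_{\alpha\in\mathrm{cov}_\infty(X)}H^n(X_\alpha;G)$. For a closed subset $A\subseteq X$ with inclusion $i:A\to X$, each $\alpha\in\mathrm{cov}_\infty(X)$ restricts to the border cover $\{\alpha_v\cap A\}_{v\in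 V_\alpha}$ of $A$, whose nerve is a subcomplex of $X_\alpha$; the induced maps in cohomology pass to the limit and give $i^*_{A,\infty}:\hat H^n_\infty(X;G)\to\hat H^n_\infty(A;G)$. Čech cohomology based on finite open covers. $\hat H^n_f(Y;G)$ is defined in the same way, as a direct limit over all finite open covers of $Y$, with induced homomorphisms for inclusions of closed subsets $B\subseteq Y$. Border small cohomological dimension. For a normal space $X$, $d^f_\infty(X;G)\in\{0,1,2,\dots\}\cup\{+\infty\}$ is the smallest integer $n$ such that for every $m\ge n$ and every closed $A\subseteq X$ the homomorphism $i^*_{A,\infty}:\hat H^m_\infty(X;G)\to\hat H^m_\infty(A;G)$ is an epimorphism ($+\infty$ if there is no such $n$). Small cohomological dimension. $d_f(Y;G)\in\{0,1,2,\dots\}\cup\{+\infty\}$ is the smallest integer $n$ such that for every $m\ge n$ and every closed $B\subseteq Y$ the homomorphism $\hat H^m_f(Y;G)\to\hat H^m_f(B;G)$ induced by the inclusion is an epimorphism ($+\infty$ if there is no such $n$). *)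

theory Defs
  imports "HOL-Analysis.Analysis" "HOL-Algebra.FiniteProduct" "HOL-Algebra.Product_Groups" "HOL-Library.Extended_Nat"
begin

section \<open>Cohomology of simplicial complexes\<close>

text \<open>A simplicial complex is given by its set of simplexes. Cohomology is computed from the ordered
  cochain complex: an \<open>n\<close>-cochain assigns an element of \<open>G\<close> to every \<open>(n+1)\<close>-tuple of vertices
  (repetitions allowed) whose entries form a simplex. With this choice a simplicial map induces a
  cochain map without any ordering of the vertices. The group \<open>G\<close> is written multiplicatively, as
  in \<open>HOL-Algebra\<close>.\<close>

definition ordered_simplices :: "nat \<Rightarrow> 'v set set \<Rightarrow> 'v list set" where
  "ordered_simplices n K = {vs. length vs = Suc n \<and> set vs \<in> K}"

definition cochain_group :: "nat \<Rightarrow> 'v set set \<Rightarrow> ('g, 'm) monoid_scheme \<Rightarrow> ('v list \<Rightarrow> 'g) monoid" where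
  "cochain_group n K G = product_group (ordered_simplices n K) (\<lambda>_. G)"

definition face :: "nat \<Rightarrow> 'v list \<Rightarrow> 'v list" where
  "face i vs = take i vs @ drop (Suc i) vs"

definition coboundary ::
  "nat \<Rightarrow> 'v set set \<Rightarrow> ('g, 'm) monoid_scheme \<Rightarrow> ('v list \<Rightarrow> 'g) \<Rightarrow> 'v list \<Rightarrow> 'g" where
  "coboundary n K G f =
     (\<lambda>vs\<in>ordered_simplices (Suc n) K.
        finprod G (\<lambda>i. f (face i vs) [^]\<^bsub>G\<^esub> ((- 1) ^ i :: int)) {..Suc n})"

definition cocycles :: "nat \<Rightarrow> 'v set set \<Rightarrow> ('g, 'm) monoid_scheme \<Rightarrow> ('v list \<Rightarrow> 'g) set" where
  "cocycles n K G = kernel (cochain_group n K G) (cochain_group (Suc n) K G) (coboundary n K G)"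

primrec coboundaries :: "nat \<Rightarrow> 'v set set \<Rightarrow> ('g, 'm) monoid_scheme \<Rightarrow> ('v list \<Rightarrow> 'g) set" where
  "coboundaries 0 K G = {\<one>\<^bsub>cochain_group 0 K G\<^esub>}"
| "coboundaries (Suc n) K G = coboundary n K G ` carrier (cochain_group n K G)"

definition cohomology_group ::
  "nat \<Rightarrow> 'v set set \<Rightarrow> ('g, 'm) monoid_scheme \<Rightarrow> ('v list \<Rightarrow> 'g) set monoid" where
  "cohomology_group n K G =
     (cochain_group n K G)\<lparr>carrier := cocycles n K G\<rparr> Mod coboundaries n K G"

definition cochain_map ::
  "nat \<Rightarrow> 'w set set \<Rightarrow> ('w \<Rightarrow> 'v) \<Rightarrow> ('v list \<Rightarrow> 'g) \<Rightarrow> 'w list \<Rightarrow> 'g" where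
  "cochain_map n L p f = (\<lambda>vs\<in>ordered_simplices n L. f (map p vs))"

text \<open>The homomorphism \<open>H\<^sup>n(K;G) \<rightarrow> H\<^sup>n(L;G)\<close> induced by a simplicial map \<open>L \<rightarrow> K\<close> with vertex
  map \<open>p\<close>. A class \<open>c\<close> is a coset; all its elements \<open>z\<close> contribute the same coset to the union.\<close>

definition cohomology_map ::
  "nat \<Rightarrow> ('g, 'm) monoid_scheme \<Rightarrow> 'w set set \<Rightarrow> ('w \<Rightarrow> 'v) \<Rightarrow> ('v list \<Rightarrow> 'g) set \<Rightarrow> ('w list \<Rightarrow> 'g) set"
  where
  "cohomology_map n G L p c =
     (\<Union>z\<in>c. coboundaries n L G #>\<^bsub>cochain_group n L G\<^esub> cochain_map n L p z)"

section \<open>Direct limits of directed systems of groups\<close>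

definition dirlim_rel ::
  "'i set \<Rightarrow> ('i \<Rightarrow> 'i \<Rightarrow> bool) \<Rightarrow> ('i \<Rightarrow> ('x, 'm) monoid_scheme) \<Rightarrow> ('i \<Rightarrow> 'i \<Rightarrow> 'x \<Rightarrow> 'x)
    \<Rightarrow> (('i \<times> 'x) \<times> ('i \<times> 'x)) set" where
  "dirlim_rel I prec H \<phi> =
     {((i, x), (j, y)). i \<in> I \<and> x \<in> carrier (H i) \<and> j \<in> I \<and> y \<in> carrier (H j) \<and>
        (\<exists>k\<in>I. prec i k \<and> prec j k \<and> \<phi> i k x = \<phi> j k y)}"

text \<open>For a directed system, the unions below are unions of a single equivalence class.\<close>

definition direct_limit ::
  "'i set \<Rightarrow> ('i \<Rightarrow> 'i \<Rightarrow> bool) \<Rightarrow> ('i \<Rightarrow> ('x, 'm) monoid_scheme) \<Rightarrow> ('i \<Rightarrow> 'i \<Rightarrow> 'x \<Rightarrow> 'x)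
    \<Rightarrow> ('i \<times> 'x) set monoid" where
  "direct_limit I prec H \<phi> =
     \<lparr>carrier = (SIGMA i:I. carrier (H i)) // dirlim_rel I prec H \<phi>,
      monoid.mult = (\<lambda>P Q. \<Union>{dirlim_rel I prec H \<phi> `` {(k, \<phi> i k x \<otimes>\<^bsub>H k\<^esub> \<phi> j k y)} | i x j y k.
                 (i, x) \<in> P \<and> (j, y) \<in> Q \<and> k \<in> I \<and> prec i k \<and> prec j k}),
      one = (\<Union>i\<in>I. dirlim_rel I prec H \<phi> `` {(i, \<one>\<^bsub>H i\<^esub>)})\<rparr>"

text \<open>The map of direct limits induced by an index map \<open>\<rho>\<close> and homomorphisms \<open>f i\<close> from the
  \<open>i\<close>-th group of the source system to the \<open>\<rho> i\<close>-th group of the target system;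
  \<open>R\<close> is the equivalence relation \<^const>\<open>dirlim_rel\<close> of the target system.\<close>

definition dirlim_map ::
  "(('j \<times> 'y) \<times> ('j \<times> 'y)) set \<Rightarrow> ('i \<Rightarrow> 'j) \<Rightarrow> ('i \<Rightarrow> 'x \<Rightarrow> 'y) \<Rightarrow> ('i \<times> 'x) set \<Rightarrow> ('j \<times> 'y) set" where
  "dirlim_map R \<rho> f P = (\<Union>(i, x)\<in>P. R `` {(\<rho> i, f i x)})"

section \<open>Indexed families, nerves and refinements\<close>

text \<open>A finite indexed family is a pair of an index set and a function on it. Every finite index
  set is in bijection with a finite set of natural numbers, so taking index sets in \<^typ>\<open>nat\<close>
  makes the families of subsets of \<open>X\<close> a set without changing any of the direct limits.\<close>

type_synonym 'a indexed_family = "nat set \<times> (nat \<Rightarrow> 'a set)"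

definition nerve :: "'a indexed_family \<Rightarrow> nat set set" where
  "nerve \<alpha> = {s. s \<noteq> {} \<and> finite s \<and> s \<subseteq> fst \<alpha> \<and> (\<Inter>v\<in>s. snd \<alpha> v) \<noteq> {}}"

definition is_refinement_projection ::
  "'a indexed_family \<Rightarrow> 'a indexed_family \<Rightarrow> (nat \<Rightarrow> nat) \<Rightarrow> bool" where
  "is_refinement_projection \<alpha> \<beta> p \<longleftrightarrow>
     p \<in> fst \<beta> \<rightarrow> fst \<alpha> \<and> (\<forall>v\<in>fst \<beta>. snd \<beta> v \<subseteq> snd \<alpha> (p v))"

definition refined_by :: "'a indexed_family \<Rightarrow> 'a indexed_family \<Rightarrow> bool" where
  "refined_by \<alpha> \<beta> \<longleftrightarrow> (\<exists>p. is_refinement_projection \<alpha> \<beta> p)"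

text \<open>The homomorphism \<open>H\<^sup>n(X\<^sub>\<alpha>;G) \<rightarrow> H\<^sup>n(X\<^sub>\<beta>;G)\<close>. The choice of projection is immaterial,
  since any two refinement projections are contiguous.\<close>

definition bonding_map ::
  "nat \<Rightarrow> ('g, 'm) monoid_scheme \<Rightarrow> 'a indexed_family \<Rightarrow> 'a indexed_family
    \<Rightarrow> (nat list \<Rightarrow> 'g) set \<Rightarrow> (nat list \<Rightarrow> 'g) set" where
  "bonding_map n G \<alpha> \<beta> =
     cohomology_map n G (nerve \<beta>) (SOME p. is_refinement_projection \<alpha> \<beta> p)"

definition restrict_family :: "'a set \<Rightarrow> 'a indexed_family \<Rightarrow> 'a indexed_family" where
  "restrict_family A \<alpha> = (fst \<alpha>, \<lambda>v\<in>fst \<alpha>. snd \<alpha> v \<inter> A)"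

definition border_covers :: "'a topology \<Rightarrow> 'a indexed_family set" where
  "border_covers X =
     {(V, \<alpha>). finite V \<and> \<alpha> \<in> V \<rightarrow>\<^sub>E {U. openin X U} \<and>
        compactin X (topspace X - (\<Union>v\<in>V. \<alpha> v))}"

definition finite_open_covers :: "'a topology \<Rightarrow> 'a indexed_family set" where
  "finite_open_covers X =
     {(V, \<alpha>). finite V \<and> \<alpha> \<in> V \<rightarrow>\<^sub>E {U. openin X U} \<and> (\<Union>v\<in>V. \<alpha> v) = topspace X}"

section \<open>Border cohomology, Cech cohomology and the small dimensions\<close>

text \<open>The two theories differ only in the class of families over which the limit is taken, so the
  limit group and the restriction homomorphism are defined for an arbitrary set \<open>C\<close> of families.\<close>

abbreviation nerve_cohomology ::
  "nat \<Rightarrow> ('g, 'm) monoid_scheme \<Rightarrow> 'a indexed_family \<Rightarrow> (nat list \<Rightarrow> 'g) set monoid" where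
  "nerve_cohomology n G \<equiv> \<lambda>\<alpha>. cohomology_group n (nerve \<alpha>) G"

definition limit_cohomology ::
  "'a indexed_family set \<Rightarrow> nat \<Rightarrow> ('g, 'm) monoid_scheme
    \<Rightarrow> ('a indexed_family \<times> (nat list \<Rightarrow> 'g) set) set monoid" where
  "limit_cohomology C n G = direct_limit C refined_by (nerve_cohomology n G) (bonding_map n G)"

text \<open>Here \<open>C\<close> is the set of families for the closed subset \<open>A\<close>. The nerve of the restricted family
  is a subcomplex of the nerve of the family, included by the identity on vertices.\<close>

definition limit_restriction ::
  "'a indexed_family set \<Rightarrow> nat \<Rightarrow> ('g, 'm) monoid_scheme \<Rightarrow> 'a set
    \<Rightarrow> ('a indexed_family \<times> (nat list \<Rightarrow> 'g) set) set
    \<Rightarrow> ('a indexed_family \<times> (nat list \<Rightarrow> 'g) set) set" where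
  "limit_restriction C n G A =
     dirlim_map (dirlim_rel C refined_by (nerve_cohomology n G) (bonding_map n G))
       (restrict_family A) (\<lambda>\<alpha>. cohomology_map n G (nerve (restrict_family A \<alpha>)) id)"

definition border_cohomology ::
  "nat \<Rightarrow> 'a topology \<Rightarrow> ('g, 'm) monoid_scheme
    \<Rightarrow> ('a indexed_family \<times> (nat list \<Rightarrow> 'g) set) set monoid" where
  "border_cohomology n X G = limit_cohomology (border_covers X) n G"

definition border_restriction ::
  "nat \<Rightarrow> 'a topology \<Rightarrow> ('g, 'm) monoid_scheme \<Rightarrow> 'a set
    \<Rightarrow> ('a indexed_family \<times> (nat list \<Rightarrow> 'g) set) set
    \<Rightarrow> ('a indexed_family \<times> (nat list \<Rightarrow> 'g) set) set" where
  "border_restriction n X G A = limit_restriction (border_covers (subtopology X A)) n G A"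

definition finite_cech_cohomology ::
  "nat \<Rightarrow> 'a topology \<Rightarrow> ('g, 'm) monoid_scheme
    \<Rightarrow> ('a indexed_family \<times> (nat list \<Rightarrow> 'g) set) set monoid" where
  "finite_cech_cohomology n X G = limit_cohomology (finite_open_covers X) n G"

definition finite_cech_restriction ::
  "nat \<Rightarrow> 'a topology \<Rightarrow> ('g, 'm) monoid_scheme \<Rightarrow> 'a set
    \<Rightarrow> ('a indexed_family \<times> (nat list \<Rightarrow> 'g) set) set
    \<Rightarrow> ('a indexed_family \<times> (nat list \<Rightarrow> 'g) set) set" where
  "finite_cech_restriction n X G A = limit_restriction (finite_open_covers (subtopology X A)) n G A"

text \<open>In \<^typ>\<open>enat\<close> the infimum of the empty set is \<open>\<infinity>\<close>.\<close>

definition border_small_dimension :: "'a topology \<Rightarrow> ('g, 'm) monoid_scheme \<Rightarrow> enat" where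
  "border_small_dimension X G =
     Inf (enat ` {n. \<forall>m\<ge>n. \<forall>A. closedin X A \<longrightarrow>
        border_restriction m X G A
          \<in> epi (border_cohomology m X G) (border_cohomology m (subtopology X A) G)})"

definition small_dimension :: "'a topology \<Rightarrow> ('g, 'm) monoid_scheme \<Rightarrow> enat" where
  "small_dimension Y G =
     Inf (enat ` {n. \<forall>m\<ge>n. \<forall>B. closedin Y B \<longrightarrow>
        finite_cech_restriction m Y G B
          \<in> epi (finite_cech_cohomology m Y G) (finite_cech_cohomology m (subtopology Y B) G)})"

section \<open>The Stone-Cech compactification\<close>

text \<open>The closure of the image of \<open>X\<close> under evaluation in the cube \<open>[0,1]\<^sup>F\<close>, where \<open>F\<close> is the set
  of continuous functions \<open>X \<rightarrow> [0,1]\<close>. Since HOL functions are total, elements of \<open>F\<close> are taken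
  to be \<^const>\<open>undefined\<close> off \<^term>\<open>topspace X\<close>.\<close>

definition unit_functions :: "'a topology \<Rightarrow> ('a \<Rightarrow> real) set" where
  "unit_functions X = {f \<in> extensional (topspace X). continuous_map X (top_of_set {0..1}) f}"

definition unit_cube :: "'a topology \<Rightarrow> (('a \<Rightarrow> real) \<Rightarrow> real) topology" where
  "unit_cube X = product_topology (\<lambda>_. top_of_set {0..1}) (unit_functions X)"

definition stone_cech_embedding :: "'a topology \<Rightarrow> 'a \<Rightarrow> ('a \<Rightarrow> real) \<Rightarrow> real" where
  "stone_cech_embedding X x = (\<lambda>f\<in>unit_functions X. f x)"

definition stone_cech :: "'a topology \<Rightarrow> (('a \<Rightarrow> real) \<Rightarrow> real) topology" where
  "stone_cech X =
     subtopology (unit_cube X) (unit_cube X closure_of (stone_cech_embedding X ` topspace X))"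

definition stone_cech_remainder :: "'a topology \<Rightarrow> (('a \<Rightarrow> real) \<Rightarrow> real) topology" where
  "stone_cech_remainder X =
     subtopology (stone_cech X) (topspace (stone_cech X) - stone_cech_embedding X ` topspace X)"

end

theory Submission
  imports Defs
begin

text \<open>Write \<open>Y = \<beta>X \ X\<close> and let \<open>cl\<close> be closure in \<open>\<beta>X\<close>. Surjectivity of a restriction map means that every
  cocycle on the nerve of a cover of the closed subset becomes, after refinement, cohomologous to the
  restriction of a cocycle on the nerve of a cover of the whole space. Such liftings are moved between
  \<open>X\<close> and \<open>Y\<close> at the level of covers. A border cover \<open>\<delta>\<close> of a closed \<open>A \<subseteq> X\<close> gives the open sets
  \<open>\<beta>X \ cl (A \ \<delta>\<^sub>v)\<close>, which cover \<open>cl A \<inter> Y\<close> because \<open>cl F \<inter> cl F' = cl (F \<inter> F')\<close> for closed \<open>F\<close>, \<open>F'\<close>,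
  and the nerve of the trace embeds into that of \<open>\<delta>\<close>. Conversely, open sets \<open>W\<^sub>v\<close> of \<open>\<beta>X\<close> covering a closed
  subset of \<open>Y\<close> miss only a compact \<open>K \<subseteq> X\<close>; since \<open>X\<close> is metrizable, \<open>K\<close> is a \<open>G\<^sub>\<delta>\<close> in \<open>\<beta>X\<close>, so \<open>\<beta>X \ K\<close>
  is Lindelof, hence normal, and the \<open>W\<^sub>v\<close> can be shrunk. Intersections of the shrunk sets which do not
  correspond to simplexes are relatively compact in \<open>X\<close>, and deleting these finitely many intersections
  leaves a border cover whose nerve maps to the nerve of the given cover. The two constructions also
  handle closed sets \<open>B \<subseteq> Y\<close> which are not of the form \<open>cl A \<inter> Y\<close>: the cover of \<open>B\<close> spreads to a closed
  \<open>A \<subseteq> X\<close> with \<open>B \<subseteq> cl A\<close>.\<close>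

section \<open>Cochains and the prism operator\<close>

text \<open>Recursive form of the coboundary on total functions: a face of \<open>v # vs\<close>
  either drops \<open>v\<close> or keeps it and drops a later entry, and in the second case every
  sign is reversed. No simplex conditions have to be carried through the inductions.\<close>

primrec alternating_sum :: "('g, 'm) monoid_scheme \<Rightarrow> ('v list \<Rightarrow> 'g) \<Rightarrow> 'v list \<Rightarrow> 'g" where
  "alternating_sum G f [] = \<one>\<^bsub>G\<^esub>"
| "alternating_sum G f (v # vs) = f vs \<otimes>\<^bsub>G\<^esub> inv\<^bsub>G\<^esub> alternating_sum G (\<lambda>ws. f (v # ws)) vs"

text \<open>The usual chain homotopy between two contiguous maps, the alternating sum of the values
  \<open>f [p v\<^sub>0, \<dots>, p v\<^sub>i, q v\<^sub>i, \<dots>, q v\<^sub>n]\<close>, written recursively so that the homotopy formula follows by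
  induction on the list.\<close>

primrec prism ::
  "('g, 'm) monoid_scheme \<Rightarrow> ('w \<Rightarrow> 'v) \<Rightarrow> ('w \<Rightarrow> 'v) \<Rightarrow> ('v list \<Rightarrow> 'g) \<Rightarrow> 'w list \<Rightarrow> 'g" where
  "prism G p q f [] = \<one>\<^bsub>G\<^esub>"
| "prism G p q f (v # vs) =
     f (p v # q v # map q vs) \<otimes>\<^bsub>G\<^esub> inv\<^bsub>G\<^esub> prism G p q (\<lambda>ws. f (p v # ws)) vs"

lemma face_Cons [simp]: "face 0 (v # vs) = vs" "face (Suc i) (v # vs) = v # face i vs"
  by (simp_all add: face_def)

lemma length_face: "i < length vs \<Longrightarrow> length (face i vs) = length vs - 1"
  by (auto simp: face_def)

lemma set_face_subset: "set (face i vs) \<subseteq> set vs"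
  by (auto simp: face_def dest: in_set_takeD in_set_dropD)

lemma map_face: "map p (face i vs) = face i (map p vs)"
  by (simp add: face_def take_map drop_map)

context comm_group
begin

lemma finprod_inv:
  assumes "finite A" "f \<in> A \<rightarrow> carrier G"
  shows "finprod G (\<lambda>i. inv f i) A = inv finprod G f A"
  using assms
proof (induction A)
  case (insert a A)
  then show ?case
    by (simp add: finprod_insert Pi_iff inv_mult)
qed simp

text \<open>Splitting off index 0 and reindexing the others by \<open>Suc\<close> reproduces the
  recursion.\<close>

lemma finprod_faces:
  assumes "\<And>ws. f ws \<in> carrier G"
  shows "finprod G (\<lambda>i. f (face i vs) [^] ((- 1) ^ i :: int)) {..<length vs} = alternating_sum G f vs"
  using assms
proof (induction vs arbitrary: f)
  case (Cons v vs)
  let ?h = "\<lambda>i. f (face i (v # vs)) [^] ((- 1) ^ i :: int)"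
  have "finprod G ?h {..<length (v # vs)} = finprod G ?h (insert 0 (Suc ` {..<length vs}))"
    by (simp add: lessThan_Suc_eq_insert_0)
  also have "\<dots> = ?h 0 \<otimes> finprod G ?h (Suc ` {..<length vs})"
    by (rule finprod_insert) (auto simp: Cons.prems)
  also have "finprod G ?h (Suc ` {..<length vs}) = finprod G (?h \<circ> Suc) {..<length vs}"
    by (subst finprod_reindex) (auto simp: Cons.prems o_def)
  \<comment> \<open>The shift by one reverses the sign, which is the \<open>inv\<close> of the
    recursion.\<close>
  also have "?h \<circ> Suc = (\<lambda>i. inv (f (v # face i vs) [^] ((- 1) ^ i :: int)))"
    by (auto simp: int_pow_neg Cons.prems)
  also have "finprod G \<dots> {..<length vs} = inv alternating_sum G (\<lambda>ws. f (v # ws)) vs"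
    using Cons.IH[of "\<lambda>ws. f (v # ws)"] by (subst finprod_inv) (auto simp: Cons.prems)
  finally show ?case
    by (simp add: Cons.prems)
qed simp

lemma alternating_sum_closed:
  "(\<And>ws. f ws \<in> carrier G) \<Longrightarrow> alternating_sum G f vs \<in> carrier G"
  by (induction vs arbitrary: f) auto

lemma prism_closed: "(\<And>ws. f ws \<in> carrier G) \<Longrightarrow> prism G p q f vs \<in> carrier G"
  by (induction vs arbitrary: f) auto

text \<open>The recursion hides which lists are evaluated, so both sides are turned back into
  products over the faces.\<close>

lemma alternating_sum_cong:
  assumes "\<And>i. i < length vs \<Longrightarrow> f (face i vs) = g (face i vs)"
    and "\<And>ws. f ws \<in> carrier G" "\<And>ws. g ws \<in> carrier G"
  shows "alternating_sum G f vs = alternating_sum G g vs"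
  unfolding finprod_faces[OF assms(2), symmetric] finprod_faces[OF assms(3), symmetric]
  by (rule finprod_cong') (use assms in auto)

lemma mult_inv_interchange:
  assumes "a \<in> carrier G" "b \<in> carrier G" "c \<in> carrier G" "d \<in> carrier G"
  shows "(a \<otimes> b) \<otimes> inv (c \<otimes> d) = (a \<otimes> inv c) \<otimes> (b \<otimes> inv d)"
  using assms by (simp add: inv_mult m_ac)

lemma alternating_sum_mult:
  assumes "\<And>ws. f ws \<in> carrier G" "\<And>ws. g ws \<in> carrier G"
  shows "alternating_sum G (\<lambda>ws. f ws \<otimes> g ws) vs = alternating_sum G f vs \<otimes> alternating_sum G g vs"
  using assms
  by (induction vs arbitrary: f g) (simp_all add: mult_inv_interchange alternating_sum_closed)

lemma alternating_sum_inv: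
  assumes "\<And>ws. f ws \<in> carrier G"
  shows "alternating_sum G (\<lambda>ws. inv f ws) vs = inv alternating_sum G f vs"
  using assms
  by (induction vs arbitrary: f) (simp_all add: inv_mult alternating_sum_closed)

lemma prism_mult:
  assumes "\<And>ws. f ws \<in> carrier G" "\<And>ws. g ws \<in> carrier G"
  shows "prism G p q (\<lambda>ws. f ws \<otimes> g ws) vs = prism G p q f vs \<otimes> prism G p q g vs"
  using assms
  by (induction vs arbitrary: f g) (simp_all add: mult_inv_interchange prism_closed)

lemma prism_inv:
  assumes "\<And>ws. f ws \<in> carrier G"
  shows "prism G p q (\<lambda>ws. inv f ws) vs = inv prism G p q f vs"
  using assms by (induction vs arbitrary: f) (simp_all add: inv_mult prism_closed)

lemma alternating_sum_map: "alternating_sum G (\<lambda>ws. f (map p ws)) vs = alternating_sum G f (map p vs)"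
proof (induction vs arbitrary: f)
  case (Cons v vs)
  from Cons[of "\<lambda>ws. f (p v # ws)"] show ?case by simp
qed simp

text \<open>\<open>prism\<close> evaluates its function only at lists one entry longer whose entries
  are images under \<open>p\<close> or \<open>q\<close>. For contiguous maps and a cocycle, the
  coboundary vanishes on these lists.\<close>

lemma prism_trivial:
  assumes "\<And>ws. length ws = Suc (length vs) \<Longrightarrow> set ws \<subseteq> p ` set vs \<union> q ` set vs \<Longrightarrow> f ws = \<one>"
  shows "prism G p q f vs = \<one>"
  using assms
proof (induction vs arbitrary: f)
  case (Cons v vs)
  have "prism G p q (\<lambda>ws. f (p v # ws)) vs = \<one>"
    by (rule Cons.IH) (auto intro!: Cons.prems)
  moreover have "f (p v # q v # map q vs) = \<one>"
    by (rule Cons.prems) auto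
  ultimately show ?case by simp
qed simp

text \<open>The homotopy identity in multiplicative form. Stating it for total functions lets the
  induction replace \<open>f\<close> by \<open>\<lambda>ws. f (p v # ws)\<close>.\<close>

lemma prism_homotopy:
  assumes "\<And>ws. f ws \<in> carrier G"
  shows "alternating_sum G (prism G p q f) vs \<otimes> prism G p q (alternating_sum G f) vs
    = f (map q vs) \<otimes> inv f (map p vs)"
  using assms
proof (induction vs arbitrary: f)
  case (Cons v vs)
  let ?S = "alternating_sum G" and ?P = "prism G p q"
  note cl = Cons.prems alternating_sum_closed prism_closed
  \<comment> \<open>Expanding both terms at \<open>v # vs\<close> leaves \<open>f\<close> with the
    first vertex \<open>p v\<close>, or the first two vertices \<open>p v\<close> and
    \<open>q v\<close>, held fixed.\<close>
  define fp where "fp = (\<lambda>ws. f (p v # ws))"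
  define fpq where "fpq = (\<lambda>ws. f (p v # q v # ws))"
  have [simp]: "fp ws \<in> carrier G" "fpq ws \<in> carrier G" "f ws \<in> carrier G" for ws
    by (auto simp: fp_def fpq_def cl)
  note [simp] = alternating_sum_closed prism_closed
  define A where "A = ?P f vs"
  define B where "B = ?S fpq (map q vs)"
  define C where "C = ?S (?P fp) vs"
  define D where "D = ?P (?S fp) vs"
  define x where "x = f (q v # map q vs)"
  define y where "y = f (p v # map q vs)"
  define z where "z = f (p v # map p vs)"
  have clABC [simp]: "A \<in> carrier G" "B \<in> carrier G" "C \<in> carrier G" "D \<in> carrier G"
    "x \<in> carrier G" "y \<in> carrier G" "z \<in> carrier G"
    by (auto simp: A_def B_def C_def D_def x_def y_def z_def)
  have IH: "C \<otimes> D = y \<otimes> inv z"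
    using Cons.IH[of fp] by (simp add: C_def D_def y_def z_def fp_def Cons.prems)
  have 1: "?S (?P f) (v # vs) = A \<otimes> (inv B \<otimes> C)"
  proof -
    have "?S (\<lambda>ws. ?P f (v # ws)) vs = ?S (\<lambda>ws. fpq (map q ws) \<otimes> inv ?P fp ws) vs"
      by (simp add: fp_def fpq_def)
    also have "\<dots> = B \<otimes> inv C"
      by (simp add: alternating_sum_mult alternating_sum_inv B_def C_def
          alternating_sum_map[where f = fpq])
    finally show ?thesis
      by (simp add: A_def inv_mult)
  qed
  have 2: "?P (?S f) (v # vs) = (x \<otimes> inv y \<otimes> B) \<otimes> (inv A \<otimes> D)"
  proof -
    have "?P (\<lambda>ws. ?S f (p v # ws)) vs = ?P (\<lambda>ws. f ws \<otimes> inv ?S fp ws) vs"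
      by (simp add: fp_def)
    also have "\<dots> = A \<otimes> inv D"
      by (simp add: prism_mult prism_inv A_def D_def)
    finally have "?P (?S f) (v # vs) = ?S f (p v # q v # map q vs) \<otimes> inv (A \<otimes> inv D)"
      by simp
    also have "?S f (p v # q v # map q vs) = x \<otimes> inv (y \<otimes> inv B)"
      by (simp add: x_def y_def B_def fpq_def)
    finally show ?thesis
      by (simp add: inv_mult m_assoc)
  qed
  \<comment> \<open>\<open>A\<close> and \<open>B\<close> occur in the two terms with opposite
    signs, \<open>C \<otimes> D\<close> is evaluated by the induction hypothesis, and the mixed
    value \<open>y\<close> telescopes.\<close>
  have "?S (?P f) (v # vs) \<otimes> ?P (?S f) (v # vs)
      = (A \<otimes> inv A) \<otimes> (B \<otimes> inv B) \<otimes> (x \<otimes> inv y \<otimes> (C \<otimes> D))"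
    unfolding 1 2 by (simp only: m_ac m_closed inv_closed clABC)
  also have "\<dots> = (A \<otimes> inv A) \<otimes> (B \<otimes> inv B) \<otimes> (x \<otimes> inv z \<otimes> (y \<otimes> inv y))"
    unfolding IH by (simp only: m_ac m_closed inv_closed clABC)
  finally show ?case
    by (simp add: x_def z_def)
qed simp

end

section \<open>Simplicial complexes, induced cochain maps and contiguity\<close>

definition simplicial_complex :: "'v set set \<Rightarrow> bool" where
  "simplicial_complex K \<longleftrightarrow> (\<forall>s\<in>K. \<forall>t\<subseteq>s. t \<noteq> {} \<longrightarrow> t \<in> K)"

definition contiguous :: "'w set set \<Rightarrow> 'v set set \<Rightarrow> ('w \<Rightarrow> 'v) \<Rightarrow> ('w \<Rightarrow> 'v) \<Rightarrow> bool" where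
  "contiguous L K p q \<longleftrightarrow> (\<forall>s\<in>L. p ` s \<union> q ` s \<in> K)"

text \<open>A map contiguous to itself sends simplexes to simplexes, so facts about contiguity
  specialise to simplicial maps.\<close>

abbreviation simplicial_map :: "'w set set \<Rightarrow> 'v set set \<Rightarrow> ('w \<Rightarrow> 'v) \<Rightarrow> bool" where
  "simplicial_map L K p \<equiv> contiguous L K p p"

text \<open>Cochains are \<open>undefined\<close> off the ordered simplexes, whereas
  \<open>alternating_sum\<close> and \<open>prism\<close> work with total functions into the
  group.\<close>

definition extend_by_one :: "('g, 'm) monoid_scheme \<Rightarrow> 'b set \<Rightarrow> ('b \<Rightarrow> 'g) \<Rightarrow> 'b \<Rightarrow> 'g" where
  "extend_by_one G S f = (\<lambda>x. if x \<in> S then f x else \<one>\<^bsub>G\<^esub>)"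

lemma face_ordered_simplices:
  assumes "simplicial_complex K" "vs \<in> ordered_simplices (Suc n) K" "i < length vs"
  shows "face i vs \<in> ordered_simplices n K"
proof -
  have "length (face i vs) = Suc n"
    using assms by (simp add: length_face ordered_simplices_def)
  moreover from this have "set (face i vs) \<noteq> {}"
    by (metis length_greater_0_conv set_empty zero_less_Suc)
  ultimately show ?thesis
    using assms set_face_subset[of i vs] by (auto simp: ordered_simplices_def simplicial_complex_def)
qed

lemma map_ordered_simplices:
  "simplicial_map L K p \<Longrightarrow> vs \<in> ordered_simplices n L \<Longrightarrow> map p vs \<in> ordered_simplices n K"
  by (auto simp: ordered_simplices_def contiguous_def)

lemma carrier_cochain_group [simp]:
  "carrier (cochain_group n K G) = (ordered_simplices n K \<rightarrow>\<^sub>E carrier G)"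
  by (simp add: cochain_group_def)

lemma mult_cochain_group [simp]:
  "f \<otimes>\<^bsub>cochain_group n K G\<^esub> g = (\<lambda>vs\<in>ordered_simplices n K. f vs \<otimes>\<^bsub>G\<^esub> g vs)"
  by (simp add: cochain_group_def)

lemma one_cochain_group [simp]:
  "\<one>\<^bsub>cochain_group n K G\<^esub> = (\<lambda>vs\<in>ordered_simplices n K. \<one>\<^bsub>G\<^esub>)"
  by (simp add: cochain_group_def)

lemma cochain_map_cochain_map:
  assumes "simplicial_map M L q"
  shows "cochain_map n M q (cochain_map n L p z) = cochain_map n M (p \<circ> q) z"
  using map_ordered_simplices[OF assms] by (fastforce simp: cochain_map_def)

lemma simplicial_map_compose:
  "simplicial_map M L q \<Longrightarrow> simplicial_map L K p \<Longrightarrow> simplicial_map M K (p \<circ> q)"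
  unfolding contiguous_def by (metis Un_absorb image_comp)

context comm_group
begin

lemma comm_group_cochain_group: "comm_group (cochain_group n K G)"
proof -
  have "group (cochain_group n K G)"
    by (simp add: cochain_group_def is_group)
  then show ?thesis
    by (rule group.group_comm_groupI) (auto intro!: restrict_ext simp: PiE_iff m_comm)
qed

lemma group_cochain_group: "group (cochain_group n K G)"
  by (rule comm_group.axioms(2)[OF comm_group_cochain_group])

lemma extend_by_one_closed:
  "f \<in> S \<rightarrow>\<^sub>E carrier G \<Longrightarrow> extend_by_one G S f x \<in> carrier G"
  by (auto simp: extend_by_one_def)

text \<open>All faces of an ordered simplex are ordered simplexes, so the product over the faces
  never meets a filler value of \<open>extend_by_one\<close>.\<close>

lemma coboundary_eq_alternating_sum:
  assumes "simplicial_complex K" "f \<in> carrier (cochain_group n K G)"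
    and "vs \<in> ordered_simplices (Suc n) K"
  shows "coboundary n K G f vs = alternating_sum G (extend_by_one G (ordered_simplices n K) f) vs"
proof -
  let ?e = "extend_by_one G (ordered_simplices n K) f"
  have e: "?e ws \<in> carrier G" for ws
    using assms by (simp add: extend_by_one_closed)
  have "length vs = Suc (Suc n)"
    using assms by (simp add: ordered_simplices_def)
  then have "{..Suc n} = {..<length vs}"
    by auto
  moreover have "f (face i vs) = ?e (face i vs)" if "i < length vs" for i
    using face_ordered_simplices[OF assms(1,3) that] by (simp add: extend_by_one_def)
  ultimately show ?thesis
    using assms(3) unfolding coboundary_def finprod_faces[of ?e, OF e, symmetric]
    by (auto intro!: finprod_cong' simp: e)
qed

lemma coboundary_hom:
  assumes "simplicial_complex K"
  shows "coboundary n K G \<in> hom (cochain_group n K G) (cochain_group (Suc n) K G)"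
proof (rule homI)
  fix f assume f: "f \<in> carrier (cochain_group n K G)"
  then have "alternating_sum G (extend_by_one G (ordered_simplices n K) f) vs \<in> carrier G" for vs
    by (intro alternating_sum_closed extend_by_one_closed) simp
  with f have "coboundary n K G f vs \<in> carrier G" if "vs \<in> ordered_simplices (Suc n) K" for vs
    using that by (simp add: coboundary_eq_alternating_sum assms)
  then show "coboundary n K G f \<in> carrier (cochain_group (Suc n) K G)"
    by (auto simp: coboundary_def)
next
  fix f g assume fg: "f \<in> carrier (cochain_group n K G)" "g \<in> carrier (cochain_group n K G)"
  let ?e = "extend_by_one G (ordered_simplices n K)"
  let ?fg = "f \<otimes>\<^bsub>cochain_group n K G\<^esub> g"
  have "?fg \<in> carrier (cochain_group n K G)"
    using fg by (auto simp: PiE_iff)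
  moreover have "?e ?fg = (\<lambda>vs. ?e f vs \<otimes> ?e g vs)"
    using fg by (auto simp: extend_by_one_def)
  moreover have "?e f vs \<in> carrier G" "?e g vs \<in> carrier G" for vs
    using fg extend_by_one_closed by auto
  ultimately have "coboundary n K G ?fg vs = coboundary n K G f vs \<otimes> coboundary n K G g vs"
    if "vs \<in> ordered_simplices (Suc n) K" for vs
    using fg that by (simp add: coboundary_eq_alternating_sum assms alternating_sum_mult del: mult_cochain_group)
  then show "coboundary n K G ?fg = coboundary n K G f \<otimes>\<^bsub>cochain_group (Suc n) K G\<^esub> coboundary n K G g"
    by (auto simp: fun_eq_iff coboundary_def)
qed

lemma coboundary_group_hom:
  "simplicial_complex K \<Longrightarrow>
    group_hom (cochain_group n K G) (cochain_group (Suc n) K G) (coboundary n K G)"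
  by (simp add: group_hom_def group_hom_axioms_def group_cochain_group coboundary_hom)

lemma subgroup_cocycles:
  "simplicial_complex K \<Longrightarrow> subgroup (cocycles n K G) (cochain_group n K G)"
  unfolding cocycles_def by (intro group_hom.subgroup_kernel coboundary_group_hom)

lemma subgroup_coboundaries:
  assumes "simplicial_complex K"
  shows "subgroup (coboundaries n K G) (cochain_group n K G)"
proof (cases n)
  case 0
  then show ?thesis
    using group.triv_subgroup[OF group_cochain_group, of 0 K] by simp
next
  case (Suc m)
  then show ?thesis
    using group_hom.img_is_subgroup[OF coboundary_group_hom[OF assms]] by simp
qed

lemma cochain_map_hom:
  assumes "simplicial_map L K p"
  shows "cochain_map n L p \<in> hom (cochain_group n K G) (cochain_group n L G)"
  using map_ordered_simplices[OF assms]
  by (intro homI) (auto simp: cochain_map_def fun_eq_iff)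

lemma coboundary_cochain_map:
  assumes "simplicial_complex L" "simplicial_map L K p"
    and "f \<in> carrier (cochain_group n K G)"
  shows "coboundary n L G (cochain_map n L p f) = cochain_map (Suc n) L p (coboundary n K G f)"
proof
  fix vs
  show "coboundary n L G (cochain_map n L p f) vs = cochain_map (Suc n) L p (coboundary n K G f) vs"
  proof (cases "vs \<in> ordered_simplices (Suc n) L")
    case True
    then have face: "face i vs \<in> ordered_simplices n L" if "i \<le> Suc n" for i
      using that assms(1) by (intro face_ordered_simplices) (auto simp: ordered_simplices_def)
    moreover have "map p vs \<in> ordered_simplices (Suc n) K"
      using assms True by (simp add: map_ordered_simplices)
    moreover have "f (map p (face i vs)) \<in> carrier G" if "i \<le> Suc n" for i
      using assms map_ordered_simplices[OF assms(2) face[OF that]] by auto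
    ultimately show ?thesis
      using True by (auto simp: coboundary_def cochain_map_def map_face intro!: finprod_cong')
  next
    case False
    then show ?thesis
      by (simp add: coboundary_def cochain_map_def)
  qed
qed

lemma cochain_map_cocycles:
  assumes "simplicial_complex L" "simplicial_map L K p" "z \<in> cocycles n K G"
  shows "cochain_map n L p z \<in> cocycles n L G"
proof -
  have z: "z \<in> carrier (cochain_group n K G)" "coboundary n K G z = \<one>\<^bsub>cochain_group (Suc n) K G\<^esub>"
    using assms(3) by (auto simp: cocycles_def kernel_def)
  have "cochain_map n L p z \<in> carrier (cochain_group n L G)"
    using hom_in_carrier[OF cochain_map_hom[OF assms(2)] z(1)] .
  moreover have "cochain_map (Suc n) L p (\<one>\<^bsub>cochain_group (Suc n) K G\<^esub>) = \<one>\<^bsub>cochain_group (Suc n) L G\<^esub>"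
    by (rule hom_one[OF cochain_map_hom[OF assms(2)] group_cochain_group group_cochain_group])
  ultimately show ?thesis
    using coboundary_cochain_map[OF assms(1,2) z(1)] z(2) by (simp add: cocycles_def kernel_def)
qed

lemma cochain_map_coboundaries:
  assumes "simplicial_complex L" "simplicial_map L K p" "b \<in> coboundaries n K G"
  shows "cochain_map n L p b \<in> coboundaries n L G"
proof (cases n)
  case 0
  then show ?thesis
    using assms(3) hom_one[OF cochain_map_hom[OF assms(2)] group_cochain_group group_cochain_group, of 0]
    by simp
next
  case (Suc m)
  with assms(3) obtain c where c: "c \<in> carrier (cochain_group m K G)" "b = coboundary m K G c"
    by auto
  then have "cochain_map n L p b = coboundary m L G (cochain_map m L p c)"
    using coboundary_cochain_map[OF assms(1,2) c(1)] Suc by simp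
  then show ?thesis
    using hom_in_carrier[OF cochain_map_hom[OF assms(2)] c(1)] Suc by auto
qed

text \<open>For a cocycle the homotopy identity loses its second term, so the pullbacks along
  \<open>p\<close> and \<open>q\<close> differ by the coboundary of the prism cochain.\<close>

lemma contiguous_cohomologous:
  assumes L: "simplicial_complex L" and K: "simplicial_complex K"
    and pq: "contiguous L K p q" and z: "z \<in> cocycles n K G"
  shows "cochain_map n L q z
    \<in> coboundaries n L G #>\<^bsub>cochain_group n L G\<^esub> cochain_map n L p z"
proof -
  let ?OL = "\<lambda>n. ordered_simplices n L" and ?OK = "\<lambda>n. ordered_simplices n K"
  define f where "f = extend_by_one G (?OK n) z"
  have zc: "z \<in> carrier (cochain_group n K G)" 
    and dz: "coboundary n K G z = \<one>\<^bsub>cochain_group (Suc n) K G\<^esub>"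
    using z by (auto simp: cocycles_def kernel_def)
  have f: "f ws \<in> carrier G" for ws
    using zc by (simp add: f_def extend_by_one_closed)
  have key: "alternating_sum G (prism G p q f) vs \<otimes> f (map p vs) = f (map q vs)"
    if vs: "vs \<in> ?OL n" for vs
  proof -
    have "alternating_sum G f ws = \<one>"
      if "length ws = Suc (length vs)" "set ws \<subseteq> p ` set vs \<union> q ` set vs" for ws
    proof -
      have "set ws \<noteq> {}"
        using that by (metis length_greater_0_conv set_empty zero_less_Suc)
      \<comment> \<open>Contiguity places all entries of \<open>ws\<close> in one simplex of
        \<open>K\<close>, so the cocycle condition applies to \<open>ws\<close>.\<close>
      moreover have "p ` set vs \<union> q ` set vs \<in> K"
        using pq vs by (auto simp: contiguous_def ordered_simplices_def)
      ultimately have "set ws \<in> K"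
        using that K unfolding simplicial_complex_def by blast
      then have "ws \<in> ?OK (Suc n)"
        using vs that by (simp add: ordered_simplices_def)
      then show ?thesis
        using coboundary_eq_alternating_sum[OF K zc] dz by (simp add: f_def)
    qed
    then have "prism G p q (alternating_sum G f) vs = \<one>"
      by (rule prism_trivial)
    then have "alternating_sum G (prism G p q f) vs = f (map q vs) \<otimes> inv f (map p vs)"
      using prism_homotopy[of f p q vs] f by (simp add: alternating_sum_closed prism_closed)
    then show ?thesis
      using f by (simp add: m_assoc)
  qed
  have map_in: "map p vs \<in> ?OK n" "map q vs \<in> ?OK n" if "vs \<in> ?OL n" for vs
  proof -
    have pqs: "p ` set vs \<union> q ` set vs \<in> K" "vs \<noteq> []"
      using pq that by (auto simp: contiguous_def ordered_simplices_def)
    have "p ` set vs \<in> K" "q ` set vs \<in> K"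
      using K pqs unfolding simplicial_complex_def
      by (metis Un_upper1 Un_upper2 image_is_empty set_empty)+
    then show "map p vs \<in> ?OK n" "map q vs \<in> ?OK n"
      using that by (auto simp: ordered_simplices_def)
  qed
  have "\<exists>b\<in>coboundaries n L G. \<forall>vs\<in>?OL n. b vs = alternating_sum G (prism G p q f) vs"
  proof (cases n)
    \<comment> \<open>In degree 0 the only coboundary is the unit, and the prism of the empty list
      is the unit as well.\<close>
    case 0
    have "alternating_sum G (prism G p q f) vs = \<one>" if "vs \<in> ?OL n" for vs
      using that 0 by (cases vs) (auto simp: ordered_simplices_def)
    then show ?thesis
      by (auto simp: 0)
  next
    case (Suc m)
    \<comment> \<open>The prism cochain lives one degree lower and is cut down to the ordered
      simplexes of \<open>L\<close>.\<close>
    define h where "h = (\<lambda>ws\<in>?OL m. prism G p q f ws)"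
    have h: "h \<in> carrier (cochain_group m L G)"
      using f by (auto simp: h_def prism_closed)
    moreover have "coboundary m L G h vs = alternating_sum G (prism G p q f) vs"
      if "vs \<in> ?OL n" for vs
    proof -
      have "coboundary m L G h vs = alternating_sum G (extend_by_one G (?OL m) h) vs"
        using that Suc by (intro coboundary_eq_alternating_sum L h) simp
      also have "\<dots> = alternating_sum G (prism G p q f) vs"
      proof (rule alternating_sum_cong)
        fix i assume "i < length vs"
        then have "face i vs \<in> ?OL m"
          using face_ordered_simplices[OF L] that Suc by blast
        then show "extend_by_one G (?OL m) h (face i vs) = prism G p q f (face i vs)"
          by (simp add: extend_by_one_def h_def)
      next
        show "extend_by_one G (?OL m) h ws \<in> carrier G" for ws
          using h by (simp add: extend_by_one_closed)
        show "prism G p q f ws \<in> carrier G" for ws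
          using f by (simp add: prism_closed)
      qed
      finally show ?thesis .
    qed
    ultimately show ?thesis
      using Suc by auto
  qed
  then obtain b where b: "b \<in> coboundaries n L G"
    "\<And>vs. vs \<in> ?OL n \<Longrightarrow> b vs = alternating_sum G (prism G p q f) vs"
    by blast
  have "cochain_map n L q z = b \<otimes>\<^bsub>cochain_group n L G\<^esub> cochain_map n L p z"
    using b(2) key map_in by (fastforce simp: cochain_map_def f_def extend_by_one_def)
  then show ?thesis
    using b(1) by (auto simp: r_coset_def)
qed

end

section \<open>Cohomology groups and induced homomorphisms\<close>

lemma carrier_cohomology_group:
  "carrier (cohomology_group n K G) =
    (\<lambda>z. coboundaries n K G #>\<^bsub>cochain_group n K G\<^esub> z) ` cocycles n K G"
  by (auto simp: cohomology_group_def FactGroup_def RCOSETS_def r_coset_def)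

lemma mult_cohomology_group:
  "P \<otimes>\<^bsub>cohomology_group n K G\<^esub> Q = P <#>\<^bsub>cochain_group n K G\<^esub> Q"
  by (simp add: cohomology_group_def FactGroup_def set_mult_def)

lemma simplicial_map_id: "L \<subseteq> K \<Longrightarrow> simplicial_map L K id"
  by (auto simp: contiguous_def)

context comm_group
begin

lemma cocycles_closed: "z \<in> cocycles n K G \<Longrightarrow> z \<in> carrier (cochain_group n K G)"
  by (auto simp: cocycles_def kernel_def)

lemma normal_coboundaries:
  "simplicial_complex K \<Longrightarrow> normal (coboundaries n K G) (cochain_group n K G)"
  using comm_group.subgroup_imp_normal[OF comm_group_cochain_group subgroup_coboundaries] .

lemma coboundary_coset_eq_iff:
  assumes "simplicial_complex K" "x \<in> carrier (cochain_group n K G)" "y \<in> carrier (cochain_group n K G)"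
  shows "coboundaries n K G #>\<^bsub>cochain_group n K G\<^esub> x = coboundaries n K G #>\<^bsub>cochain_group n K G\<^esub> y
    \<longleftrightarrow> x \<in> coboundaries n K G #>\<^bsub>cochain_group n K G\<^esub> y"
proof
  show "x \<in> coboundaries n K G #>\<^bsub>cochain_group n K G\<^esub> y"
    if "coboundaries n K G #>\<^bsub>cochain_group n K G\<^esub> x = coboundaries n K G #>\<^bsub>cochain_group n K G\<^esub> y"
    using group.rcos_self[OF group_cochain_group assms(2) subgroup_coboundaries[OF assms(1)]] that
    by simp
next
  show "coboundaries n K G #>\<^bsub>cochain_group n K G\<^esub> x = coboundaries n K G #>\<^bsub>cochain_group n K G\<^esub> y"
    if "x \<in> coboundaries n K G #>\<^bsub>cochain_group n K G\<^esub> y"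
    using group.repr_independence[OF group_cochain_group that assms(3) subgroup_coboundaries[OF assms(1)]]
    by simp
qed

lemma coset_mult_cohomology:
  assumes "simplicial_complex K" "x \<in> carrier (cochain_group n K G)" "y \<in> carrier (cochain_group n K G)"
  shows "(coboundaries n K G #>\<^bsub>cochain_group n K G\<^esub> x)
      \<otimes>\<^bsub>cohomology_group n K G\<^esub> (coboundaries n K G #>\<^bsub>cochain_group n K G\<^esub> y)
    = coboundaries n K G #>\<^bsub>cochain_group n K G\<^esub> (x \<otimes>\<^bsub>cochain_group n K G\<^esub> y)"
  unfolding mult_cohomology_group
  using normal.rcos_sum[OF normal_coboundaries[OF assms(1)] assms(2,3)] .

lemma cohomology_mult_closed:
  assumes "simplicial_complex K" "c \<in> carrier (cohomology_group n K G)" "d \<in> carrier (cohomology_group n K G)"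
  shows "c \<otimes>\<^bsub>cohomology_group n K G\<^esub> d \<in> carrier (cohomology_group n K G)"
  using assms(2,3) subgroup.m_closed[OF subgroup_cocycles[OF assms(1)]]
  unfolding carrier_cohomology_group
  by (auto simp: coset_mult_cohomology[OF assms(1)] cocycles_closed simp del: mult_cochain_group carrier_cochain_group)

text \<open>Cochain maps send coboundaries to coboundaries, so all members of the coset contribute
  the same coset to the union defining \<open>cohomology_map\<close>.\<close>

lemma cohomology_map_coset:
  assumes L: "simplicial_complex L" and K: "simplicial_complex K"
    and p: "simplicial_map L K p" and z: "z \<in> carrier (cochain_group n K G)"
  shows "cohomology_map n G L p (coboundaries n K G #>\<^bsub>cochain_group n K G\<^esub> z)
    = coboundaries n L G #>\<^bsub>cochain_group n L G\<^esub> cochain_map n L p z"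
proof -
  let ?B = "\<lambda>n K. coboundaries n K G" and ?C = "\<lambda>n K. cochain_group n K G"
  have "?B n L #>\<^bsub>?C n L\<^esub> cochain_map n L p x = ?B n L #>\<^bsub>?C n L\<^esub> cochain_map n L p z"
    if x: "x \<in> ?B n K #>\<^bsub>?C n K\<^esub> z" for x
  proof -
    obtain b where b: "b \<in> ?B n K" "x = b \<otimes>\<^bsub>?C n K\<^esub> z"
      using x by (auto simp: r_coset_def)
    then have bc: "b \<in> carrier (?C n K)"
      using subgroup.subset[OF subgroup_coboundaries[OF K]] by blast
    have "cochain_map n L p x = cochain_map n L p b \<otimes>\<^bsub>?C n L\<^esub> cochain_map n L p z"
      using hom_mult[OF cochain_map_hom[OF p] bc z] b(2) by simp
    moreover have "cochain_map n L p b \<in> ?B n L"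
      using cochain_map_coboundaries[OF L p b(1)] .
    ultimately have "cochain_map n L p x \<in> ?B n L #>\<^bsub>?C n L\<^esub> cochain_map n L p z"
      by (auto simp: r_coset_def)
    moreover have "cochain_map n L p z \<in> carrier (?C n L)"
      using hom_in_carrier[OF cochain_map_hom[OF p] z] .
    ultimately show ?thesis
      by (metis group.repr_independence[OF group_cochain_group] subgroup_coboundaries[OF L])
  qed
  moreover have "z \<in> ?B n K #>\<^bsub>?C n K\<^esub> z"
    using group.rcos_self[OF group_cochain_group z subgroup_coboundaries[OF K]] .
  ultimately show ?thesis
    unfolding cohomology_map_def by blast
qed

lemma cohomology_map_hom:
  assumes "simplicial_complex L" "simplicial_complex K" "simplicial_map L K p"
  shows "cohomology_map n G L p \<in> hom (cohomology_group n K G) (cohomology_group n L G)"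
proof (rule homI)
  show "cohomology_map n G L p c \<in> carrier (cohomology_group n L G)"
    if "c \<in> carrier (cohomology_group n K G)" for c
    using that cochain_map_cocycles[OF assms(1,3)]
    by (auto simp: carrier_cohomology_group cohomology_map_coset[OF assms] cocycles_closed
        simp del: carrier_cochain_group)
next
  fix c d assume "c \<in> carrier (cohomology_group n K G)" "d \<in> carrier (cohomology_group n K G)"
  then obtain x y where x: "x \<in> carrier (cochain_group n K G)"
      "c = coboundaries n K G #>\<^bsub>cochain_group n K G\<^esub> x"
    and y: "y \<in> carrier (cochain_group n K G)"
      "d = coboundaries n K G #>\<^bsub>cochain_group n K G\<^esub> y"
    by (auto simp: carrier_cohomology_group dest: cocycles_closed simp del: carrier_cochain_group)
  note h = cochain_map_hom[OF assms(3)]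
  have xy: "x \<otimes>\<^bsub>cochain_group n K G\<^esub> y \<in> carrier (cochain_group n K G)"
    using monoid.m_closed[OF group.is_monoid[OF group_cochain_group] x(1) y(1)] .
  show "cohomology_map n G L p (c \<otimes>\<^bsub>cohomology_group n K G\<^esub> d)
    = cohomology_map n G L p c \<otimes>\<^bsub>cohomology_group n L G\<^esub> cohomology_map n G L p d"
    unfolding x(2) y(2) coset_mult_cohomology[OF assms(2) x(1) y(1)]
      cohomology_map_coset[OF assms x(1)] cohomology_map_coset[OF assms y(1)]
      cohomology_map_coset[OF assms xy]
      coset_mult_cohomology[OF assms(1) hom_in_carrier[OF h x(1)] hom_in_carrier[OF h y(1)]]
      hom_mult[OF h x(1) y(1)] ..
qed

lemma cohomology_map_contiguous:
  assumes L: "simplicial_complex L" and K: "simplicial_complex K"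
    and p: "simplicial_map L K p" and q: "simplicial_map L K q" and pq: "contiguous L K p q"
    and c: "c \<in> carrier (cohomology_group n K G)"
  shows "cohomology_map n G L p c = cohomology_map n G L q c"
proof -
  obtain z where z: "z \<in> cocycles n K G" "c = coboundaries n K G #>\<^bsub>cochain_group n K G\<^esub> z"
    using c by (auto simp: carrier_cohomology_group)
  note zc = cocycles_closed[OF z(1)]
  show ?thesis
    unfolding z(2) cohomology_map_coset[OF L K p zc] cohomology_map_coset[OF L K q zc]
    using contiguous_cohomologous[OF L K pq z(1)]
      coboundary_coset_eq_iff[OF L hom_in_carrier[OF cochain_map_hom[OF q] zc]
        hom_in_carrier[OF cochain_map_hom[OF p] zc]]
    by simp
qed

lemma cohomology_map_compose:
  assumes "simplicial_complex M" "simplicial_complex L" "simplicial_complex K"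
    and q: "simplicial_map M L q" and p: "simplicial_map L K p"
    and c: "c \<in> carrier (cohomology_group n K G)"
  shows "cohomology_map n G M q (cohomology_map n G L p c) = cohomology_map n G M (p \<circ> q) c"
proof -
  obtain z where z: "z \<in> carrier (cochain_group n K G)"
    "c = coboundaries n K G #>\<^bsub>cochain_group n K G\<^esub> z"
    using c by (auto simp: carrier_cohomology_group dest: cocycles_closed simp del: carrier_cochain_group)
  show ?thesis
    unfolding z(2) cohomology_map_coset[OF assms(2,3) p z(1)]
      cohomology_map_coset[OF assms(1,2) q hom_in_carrier[OF cochain_map_hom[OF p] z(1)]]
      cohomology_map_coset[OF assms(1,3) simplicial_map_compose[OF q p] z(1)]
      cochain_map_cochain_map[OF q] ..
qed

end

section \<open>Direct limits\<close>

text \<open>Epimorphisms concern multiplication and surjectivity, so multiplicative closure is asked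
  of the \<open>H i\<close> in place of the group laws.\<close>

locale directed_system =
  fixes I :: "'i set" and prec :: "'i \<Rightarrow> 'i \<Rightarrow> bool" and H :: "'i \<Rightarrow> ('x, 'm) monoid_scheme"
    and \<phi> :: "'i \<Rightarrow> 'i \<Rightarrow> 'x \<Rightarrow> 'x"
  assumes prec_refl: "i \<in> I \<Longrightarrow> prec i i"
    and prec_trans: "\<lbrakk>i \<in> I; j \<in> I; k \<in> I; prec i j; prec j k\<rbrakk> \<Longrightarrow> prec i k"
    and directed: "\<lbrakk>i \<in> I; j \<in> I\<rbrakk> \<Longrightarrow> \<exists>k\<in>I. prec i k \<and> prec j k"
    and mult_closed: "\<lbrakk>i \<in> I; x \<in> carrier (H i); y \<in> carrier (H i)\<rbrakk> \<Longrightarrow> x \<otimes>\<^bsub>H i\<^esub> y \<in> carrier (H i)"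
    and bonding_hom: "\<lbrakk>i \<in> I; j \<in> I; prec i j\<rbrakk> \<Longrightarrow> \<phi> i j \<in> hom (H i) (H j)"
    and bonding_compose:
      "\<lbrakk>i \<in> I; j \<in> I; k \<in> I; prec i j; prec j k; x \<in> carrier (H i)\<rbrakk> \<Longrightarrow> \<phi> j k (\<phi> i j x) = \<phi> i k x"
begin

abbreviation rel where "rel \<equiv> dirlim_rel I prec H \<phi>"

abbreviation elements where "elements \<equiv> SIGMA i:I. carrier (H i)"

lemma bonding_closed: "\<lbrakk>i \<in> I; j \<in> I; prec i j; x \<in> carrier (H i)\<rbrakk> \<Longrightarrow> \<phi> i j x \<in> carrier (H j)"
  using bonding_hom hom_in_carrier by metis

lemma rel_iff:
  "((i, x), (j, y)) \<in> rel \<longleftrightarrow> i \<in> I \<and> x \<in> carrier (H i) \<and> j \<in> I \<and> y \<in> carrier (H j) \<and>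
    (\<exists>k\<in>I. prec i k \<and> prec j k \<and> \<phi> i k x = \<phi> j k y)"
  by (simp add: dirlim_rel_def)

lemma equiv_rel: "equiv elements rel"
proof (rule equivI)
  show "rel \<subseteq> elements \<times> elements"
    by (auto simp: dirlim_rel_def)
  show "refl_on elements rel"
    using prec_refl by (auto simp: refl_on_def rel_iff)
  show "sym rel"
    by (rule symI) (fastforce simp: dirlim_rel_def)
  show "trans rel"
  proof (rule transI, clarify)
    fix i x j y k z
    assume "((i, x), (j, y)) \<in> rel" "((j, y), (k, z)) \<in> rel"
    then obtain l m where *: "i \<in> I" "j \<in> I" "k \<in> I" "l \<in> I" "m \<in> I"
      "prec i l" "prec j l" "prec j m" "prec k m"
      "x \<in> carrier (H i)" "y \<in> carrier (H j)" "z \<in> carrier (H k)"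
      and eq: "\<phi> i l x = \<phi> j l y" "\<phi> j m y = \<phi> k m z"
      by (auto simp: rel_iff)
    \<comment> \<open>The two given equations hold at different stages; at a stage above both, the
      image of \<open>y\<close> links them.\<close>
    obtain u where u: "u \<in> I" "prec l u" "prec m u"
      using directed * by blast
    have "\<phi> i u x = \<phi> l u (\<phi> i l x)"
      using * u by (simp only: bonding_compose)
    also have "\<dots> = \<phi> l u (\<phi> j l y)"
      using eq by simp
    also have "\<dots> = \<phi> m u (\<phi> j m y)"
      using * u by (simp only: bonding_compose)
    also have "\<dots> = \<phi> m u (\<phi> k m z)"
      using eq by simp
    also have "\<dots> = \<phi> k u z"
      using * u by (simp only: bonding_compose)
    finally have "\<phi> i u x = \<phi> k u z" .
    moreover have "prec i u" "prec k u"
      using * u prec_trans by blast+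
    ultimately show "((i, x), (k, z)) \<in> rel"
      using * u unfolding rel_iff by blast
  qed
qed

text \<open>Makes the product of two classes independent of the representatives and of the stage at
  which they are multiplied.\<close>

lemma rel_mult:
  assumes "((i, x), (i', x')) \<in> rel" "((j, y), (j', y')) \<in> rel"
    and "k \<in> I" "prec i k" "prec j k" "k' \<in> I" "prec i' k'" "prec j' k'"
  shows "((k, \<phi> i k x \<otimes>\<^bsub>H k\<^esub> \<phi> j k y), (k', \<phi> i' k' x' \<otimes>\<^bsub>H k'\<^esub> \<phi> j' k' y')) \<in> rel"
proof -
  obtain l m where *: "i \<in> I" "i' \<in> I" "j \<in> I" "j' \<in> I" "l \<in> I" "m \<in> I"
      "prec i l" "prec i' l" "prec j m" "prec j' m"
      "x \<in> carrier (H i)" "x' \<in> carrier (H i')" "y \<in> carrier (H j)" "y' \<in> carrier (H j')"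
      and eq: "\<phi> i l x = \<phi> i' l x'" "\<phi> j m y = \<phi> j' m y'"
    using assms by (auto simp: rel_iff)
  \<comment> \<open>\<open>u\<close> bounds the two stages of multiplication, \<open>v\<close> the
    two stages at which representatives agree, and \<open>w\<close> bounds both, so that everything
    can be compared there.\<close>
  obtain u where u: "u \<in> I" "prec k u" "prec k' u"
    using directed assms by blast
  obtain v where v: "v \<in> I" "prec l v" "prec m v"
    using directed * by blast
  obtain w where w: "w \<in> I" "prec u w" "prec v w"
    using directed u v by blast
  have w': "prec k w" "prec k' w" "prec l w" "prec m w"
    using assms(3,6) *(5,6) u v w by (blast intro: prec_trans)+
  have w'': "prec i w" "prec i' w" "prec j w" "prec j' w"
    using *(1-10) w' w(1) by (blast intro: prec_trans)+
  note w' = w' w''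
  have 1: "\<phi> k w (\<phi> i k x \<otimes>\<^bsub>H k\<^esub> \<phi> j k y) = \<phi> i w x \<otimes>\<^bsub>H w\<^esub> \<phi> j w y"
    using * assms w w' by (simp add: hom_mult[OF bonding_hom] bonding_closed bonding_compose)
  have 2: "\<phi> k' w (\<phi> i' k' x' \<otimes>\<^bsub>H k'\<^esub> \<phi> j' k' y') = \<phi> i' w x' \<otimes>\<^bsub>H w\<^esub> \<phi> j' w y'"
    using * assms w w' by (simp add: hom_mult[OF bonding_hom] bonding_closed bonding_compose)
  have "\<phi> i w x = \<phi> l w (\<phi> i l x)" "\<phi> i' w x' = \<phi> l w (\<phi> i' l x')"
    using * w w' by (simp_all only: bonding_compose)
  moreover have "\<phi> j w y = \<phi> m w (\<phi> j m y)" "\<phi> j' w y' = \<phi> m w (\<phi> j' m y')"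
    using * w w' by (simp_all only: bonding_compose)
  ultimately have "\<phi> i w x = \<phi> i' w x'" "\<phi> j w y = \<phi> j' w y'"
    using eq by simp_all
  with 1 2 have "\<phi> k w (\<phi> i k x \<otimes>\<^bsub>H k\<^esub> \<phi> j k y) = \<phi> k' w (\<phi> i' k' x' \<otimes>\<^bsub>H k'\<^esub> \<phi> j' k' y')"
    by simp
  moreover have "\<phi> i k x \<otimes>\<^bsub>H k\<^esub> \<phi> j k y \<in> carrier (H k)"
    "\<phi> i' k' x' \<otimes>\<^bsub>H k'\<^esub> \<phi> j' k' y' \<in> carrier (H k')"
    using * assms by (simp_all add: bonding_closed mult_closed)
  ultimately show ?thesis
    unfolding rel_iff using assms w w' by blast
qed

lemma class_in_carrier:
  "i \<in> I \<Longrightarrow> x \<in> carrier (H i) \<Longrightarrow> rel `` {(i, x)} \<in> carrier (direct_limit I prec H \<phi>)"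
  by (auto simp: direct_limit_def intro!: quotientI)

lemma carrier_cases:
  assumes "P \<in> carrier (direct_limit I prec H \<phi>)"
  obtains i x where "i \<in> I" "x \<in> carrier (H i)" "P = rel `` {(i, x)}"
  using assms by (auto simp: direct_limit_def elim!: quotientE)

lemma class_eq_iff:
  assumes "i \<in> I" "x \<in> carrier (H i)" "j \<in> I" "y \<in> carrier (H j)"
  shows "rel `` {(i, x)} = rel `` {(j, y)} \<longleftrightarrow> ((i, x), (j, y)) \<in> rel"
  using assms by (intro eq_equiv_class_iff[OF equiv_rel]) auto

lemma class_mult:
  assumes "i \<in> I" "x \<in> carrier (H i)" "j \<in> I" "y \<in> carrier (H j)" "k \<in> I" "prec i k" "prec j k"
  shows "rel `` {(i, x)} \<otimes>\<^bsub>direct_limit I prec H \<phi>\<^esub> rel `` {(j, y)}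
    = rel `` {(k, \<phi> i k x \<otimes>\<^bsub>H k\<^esub> \<phi> j k y)}"
proof -
  let ?F = "{rel `` {(k', \<phi> i' k' x' \<otimes>\<^bsub>H k'\<^esub> \<phi> j' k' y')} | i' x' j' y' k'.
    (i', x') \<in> rel `` {(i, x)} \<and> (j', y') \<in> rel `` {(j, y)} \<and> k' \<in> I \<and> prec i' k' \<and> prec j' k'}"
  let ?c = "rel `` {(k, \<phi> i k x \<otimes>\<^bsub>H k\<^esub> \<phi> j k y)}"
  \<comment> \<open>By \<open>rel_mult\<close> all candidate products are one class, so the union
    defining the product runs over a singleton.\<close>
  have "?F = {?c}"
  proof (intro subset_antisym subsetI)
    fix c assume "c \<in> ?F"
    then obtain i' x' j' y' k' where c: "c = rel `` {(k', \<phi> i' k' x' \<otimes>\<^bsub>H k'\<^esub> \<phi> j' k' y')}"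
      "((i, x), (i', x')) \<in> rel" "((j, y), (j', y')) \<in> rel" "k' \<in> I" "prec i' k'" "prec j' k'"
      by blast
    then have "c = ?c"
      using equiv_class_eq[OF equiv_rel rel_mult[OF c(2,3) assms(5-7) c(4-6)]] by simp
    then show "c \<in> {?c}" by simp
  next
    fix c assume "c \<in> {?c}"
    moreover have "(i, x) \<in> rel `` {(i, x)}" "(j, y) \<in> rel `` {(j, y)}"
      using assms equiv_class_self[OF equiv_rel] by auto
    ultimately show "c \<in> ?F"
      using assms by blast
  qed
  then show ?thesis
    by (simp add: direct_limit_def)
qed

end

text \<open>The index sets may differ because restriction sends covers of a space to covers of a
  closed subset.\<close>

locale directed_system_map =
  source: directed_system I prec H \<phi> + target: directed_system J prec' H' \<phi>'
  for I :: "'i set" and prec and H :: "'i \<Rightarrow> ('x, 'm) monoid_scheme" and \<phi>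
    and J :: "'j set" and prec' and H' :: "'j \<Rightarrow> ('y, 'k) monoid_scheme" and \<phi>' +
  fixes \<rho> :: "'i \<Rightarrow> 'j" and f :: "'i \<Rightarrow> 'x \<Rightarrow> 'y"
  assumes index_closed: "i \<in> I \<Longrightarrow> \<rho> i \<in> J"
    and index_mono: "\<lbrakk>i \<in> I; j \<in> I; prec i j\<rbrakk> \<Longrightarrow> prec' (\<rho> i) (\<rho> j)"
    and map_hom: "i \<in> I \<Longrightarrow> f i \<in> hom (H i) (H' (\<rho> i))"
    and map_bonding:
      "\<lbrakk>i \<in> I; j \<in> I; prec i j; x \<in> carrier (H i)\<rbrakk> \<Longrightarrow> f j (\<phi> i j x) = \<phi>' (\<rho> i) (\<rho> j) (f i x)"
begin

lemma map_closed: "i \<in> I \<Longrightarrow> x \<in> carrier (H i) \<Longrightarrow> f i x \<in> carrier (H' (\<rho> i))"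
  using map_hom hom_in_carrier by metis

lemma rel_map:
  assumes "((i, x), (j, y)) \<in> source.rel"
  shows "((\<rho> i, f i x), (\<rho> j, f j y)) \<in> target.rel"
proof -
  obtain k where "i \<in> I" "j \<in> I" "k \<in> I" "prec i k" "prec j k" "x \<in> carrier (H i)" "y \<in> carrier (H j)"
    "\<phi> i k x = \<phi> j k y"
    using assms by (auto simp: source.rel_iff)
  then show ?thesis
    unfolding target.rel_iff
    by (intro conjI bexI[of _ "\<rho> k"]) (simp_all add: index_closed index_mono map_closed flip: map_bonding)
qed

lemma dirlim_map_class:
  assumes "i \<in> I" "x \<in> carrier (H i)"
  shows "dirlim_map target.rel \<rho> f (source.rel `` {(i, x)}) = target.rel `` {(\<rho> i, f i x)}"
proof -
  have "target.rel `` {(\<rho> j, f j y)} = target.rel `` {(\<rho> i, f i x)}"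
    if "((i, x), (j, y)) \<in> source.rel" for j y
    using equiv_class_eq[OF target.equiv_rel rel_map[OF that]] by simp
  moreover have "((i, x), (i, x)) \<in> source.rel"
    using assms equiv_class_self[OF source.equiv_rel] by auto
  ultimately show ?thesis
    unfolding dirlim_map_def by blast
qed

lemma dirlim_map_hom:
  "dirlim_map target.rel \<rho> f \<in> hom (direct_limit I prec H \<phi>) (direct_limit J prec' H' \<phi>')"
proof (rule homI)
  fix P assume "P \<in> carrier (direct_limit I prec H \<phi>)"
  then show "dirlim_map target.rel \<rho> f P \<in> carrier (direct_limit J prec' H' \<phi>')"
    by (elim source.carrier_cases)
      (simp add: dirlim_map_class target.class_in_carrier index_closed map_closed)
next
  fix P Q assume "P \<in> carrier (direct_limit I prec H \<phi>)" "Q \<in> carrier (direct_limit I prec H \<phi>)"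
  then obtain i x j y where ix: "i \<in> I" "x \<in> carrier (H i)" and P: "P = source.rel `` {(i, x)}"
    and jy: "j \<in> I" "y \<in> carrier (H j)" and Q: "Q = source.rel `` {(j, y)}"
    by (metis source.carrier_cases)
  obtain k where k: "k \<in> I" "prec i k" "prec j k"
    using source.directed ix jy by blast
  have "\<phi> i k x \<in> carrier (H k)" "\<phi> j k y \<in> carrier (H k)"
    using ix jy k source.bonding_closed by auto
  then show "dirlim_map target.rel \<rho> f (P \<otimes>\<^bsub>direct_limit I prec H \<phi>\<^esub> Q) =
      dirlim_map target.rel \<rho> f P \<otimes>\<^bsub>direct_limit J prec' H' \<phi>'\<^esub> dirlim_map target.rel \<rho> f Q"
    unfolding P Q using ix jy k
    by (simp add: source.class_mult[of i x j y k] dirlim_map_class source.mult_closed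
        target.class_mult[of "\<rho> i" _ "\<rho> j" _ "\<rho> k"] index_closed index_mono map_closed
        hom_mult[OF map_hom] map_bonding)
qed

text \<open>Removes the quotients from the surjectivity condition; afterwards only representatives
  at explicit stages have to be handled.\<close>

lemma dirlim_map_epi_iff:
  "dirlim_map target.rel \<rho> f \<in> epi (direct_limit I prec H \<phi>) (direct_limit J prec' H' \<phi>') \<longleftrightarrow>
    (\<forall>j\<in>J. \<forall>y\<in>carrier (H' j). \<exists>i\<in>I. \<exists>x\<in>carrier (H i). ((j, y), (\<rho> i, f i x)) \<in> target.rel)"
    (is "?L \<longleftrightarrow> ?R")
proof
  assume ?L
  show ?R
  proof (intro ballI)
    fix j y assume jy: "j \<in> J" "y \<in> carrier (H' j)"
    then have "target.rel `` {(j, y)} \<in> dirlim_map target.rel \<rho> f ` carrier (direct_limit I prec H \<phi>)"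
      using \<open>?L\<close> target.class_in_carrier by (simp add: epi_def)
    then obtain i x where ix: "i \<in> I" "x \<in> carrier (H i)"
      "target.rel `` {(j, y)} = dirlim_map target.rel \<rho> f (source.rel `` {(i, x)})"
      by (auto elim!: source.carrier_cases)
    then have "((j, y), (\<rho> i, f i x)) \<in> target.rel"
      using jy by (simp add: dirlim_map_class target.class_eq_iff index_closed map_closed)
    with ix show "\<exists>i\<in>I. \<exists>x\<in>carrier (H i). ((j, y), (\<rho> i, f i x)) \<in> target.rel"
      by blast
  qed
next
  assume R: ?R
  have "carrier (direct_limit J prec' H' \<phi>')
      \<subseteq> dirlim_map target.rel \<rho> f ` carrier (direct_limit I prec H \<phi>)"
  proof
    fix Q assume "Q \<in> carrier (direct_limit J prec' H' \<phi>')"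
    then obtain j y where jy: "j \<in> J" "y \<in> carrier (H' j)" "Q = target.rel `` {(j, y)}"
      by (rule target.carrier_cases)
    with R obtain i x where ix: "i \<in> I" "x \<in> carrier (H i)" "((j, y), (\<rho> i, f i x)) \<in> target.rel"
      by blast
    then have "Q = dirlim_map target.rel \<rho> f (source.rel `` {(i, x)})"
      using jy by (simp add: dirlim_map_class target.class_eq_iff index_closed map_closed)
    with ix show "Q \<in> dirlim_map target.rel \<rho> f ` carrier (direct_limit I prec H \<phi>)"
      using source.class_in_carrier by blast
  qed
  moreover have "dirlim_map target.rel \<rho> f ` carrier (direct_limit I prec H \<phi>)
      \<subseteq> carrier (direct_limit J prec' H' \<phi>')"
    using hom_in_carrier[OF dirlim_map_hom] by blast
  ultimately show ?L
    using dirlim_map_hom unfolding epi_def by blast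
qed

end

section \<open>Nerves and lifting of cohomology classes\<close>

lemma simplicial_complex_nerve: "simplicial_complex (nerve \<alpha>)"
proof -
  have "t \<in> nerve \<alpha>" if "s \<in> nerve \<alpha>" "t \<subseteq> s" "t \<noteq> {}" for s t
  proof -
    have "(\<Inter>v\<in>s. snd \<alpha> v) \<subseteq> (\<Inter>v\<in>t. snd \<alpha> v)"
      using that by blast
    then show ?thesis
      using that by (auto simp: nerve_def dest: finite_subset)
  qed
  then show ?thesis
    by (auto simp: simplicial_complex_def)
qed

lemma nerveI: "s \<noteq> {} \<Longrightarrow> finite s \<Longrightarrow> s \<subseteq> fst \<alpha> \<Longrightarrow> (\<And>v. v \<in> s \<Longrightarrow> x \<in> snd \<alpha> v) \<Longrightarrow> s \<in> nerve \<alpha>"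
  unfolding nerve_def by blast

lemma nerveE:
  assumes "s \<in> nerve \<alpha>"
  obtains x where "s \<noteq> {}" "finite s" "s \<subseteq> fst \<alpha>" "\<And>v. v \<in> s \<Longrightarrow> x \<in> snd \<alpha> v"
  using assms by (auto simp: nerve_def)

text \<open>A point common to the sets of \<open>\<beta>\<close> indexed by \<open>s\<close> lies in
  the sets of \<open>\<alpha>\<close> indexed by either image of \<open>s\<close>.\<close>

lemma contiguous_refinement_projections:
  assumes "is_refinement_projection \<alpha> \<beta> p" "is_refinement_projection \<alpha> \<beta> q"
  shows "contiguous (nerve \<beta>) (nerve \<alpha>) p q"
  unfolding contiguous_def
proof
  fix s assume "s \<in> nerve \<beta>"
  then obtain x where x: "s \<noteq> {}" "finite s" "s \<subseteq> fst \<beta>" "\<And>v. v \<in> s \<Longrightarrow> x \<in> snd \<beta> v"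
    by (rule nerveE) blast
  show "p ` s \<union> q ` s \<in> nerve \<alpha>"
    by (rule nerveI[where x = x])
      (use x assms in \<open>auto simp: is_refinement_projection_def Pi_iff subset_iff\<close>)
qed

lemma is_refinement_projection_some:
  "refined_by \<alpha> \<beta> \<Longrightarrow> is_refinement_projection \<alpha> \<beta> (SOME p. is_refinement_projection \<alpha> \<beta> p)"
  by (simp add: refined_by_def someI_ex)

lemma is_refinement_projection_id: "is_refinement_projection \<alpha> \<alpha> id"
  by (auto simp: is_refinement_projection_def)

lemma is_refinement_projection_compose:
  "is_refinement_projection \<alpha> \<beta> p \<Longrightarrow> is_refinement_projection \<beta> \<gamma> q \<Longrightarrow>
    is_refinement_projection \<alpha> \<gamma> (p \<circ> q)"
  by (fastforce simp: is_refinement_projection_def Pi_iff)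

lemma is_refinement_projection_restrict:
  "is_refinement_projection \<alpha> \<beta> p \<Longrightarrow>
    is_refinement_projection (restrict_family A \<alpha>) (restrict_family A \<beta>) p"
  by (auto simp: is_refinement_projection_def restrict_family_def Pi_iff)

lemma is_refinement_projection_restrict_id:
  "is_refinement_projection \<alpha> (restrict_family A \<alpha>) id"
  by (auto simp: is_refinement_projection_def restrict_family_def)

text \<open>The common refinement by pairwise intersections, with pairs of indices coded as natural
  numbers.\<close>

definition meet_family :: "'a indexed_family \<Rightarrow> 'a indexed_family \<Rightarrow> 'a indexed_family" where
  "meet_family \<alpha> \<beta> = (prod_encode ` (fst \<alpha> \<times> fst \<beta>),
     \<lambda>v\<in>prod_encode ` (fst \<alpha> \<times> fst \<beta>). snd \<alpha> (fst (prod_decode v)) \<inter> snd \<beta> (snd (prod_decode v)))"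

lemma meet_family_refines: "refined_by \<alpha> (meet_family \<alpha> \<beta>)" "refined_by \<beta> (meet_family \<alpha> \<beta>)"
proof -
  have "is_refinement_projection \<alpha> (meet_family \<alpha> \<beta>) (fst \<circ> prod_decode)"
    by (auto simp: is_refinement_projection_def meet_family_def)
  then show "refined_by \<alpha> (meet_family \<alpha> \<beta>)"
    by (auto simp: refined_by_def)
  have "is_refinement_projection \<beta> (meet_family \<alpha> \<beta>) (snd \<circ> prod_decode)"
    by (auto simp: is_refinement_projection_def meet_family_def)
  then show "refined_by \<beta> (meet_family \<alpha> \<beta>)"
    by (auto simp: refined_by_def)
qed

lemma Union_meet_family:
  "(\<Union>v\<in>fst (meet_family \<alpha> \<beta>). snd (meet_family \<alpha> \<beta>) v)
    = (\<Union>v\<in>fst \<alpha>. snd \<alpha> v) \<inter> (\<Union>v\<in>fst \<beta>. snd \<beta> v)"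
  by (auto simp: meet_family_def)

definition directed_families :: "'a indexed_family set \<Rightarrow> bool" where
  "directed_families C \<longleftrightarrow> (\<forall>\<alpha>\<in>C. \<forall>\<beta>\<in>C. \<exists>\<gamma>\<in>C. refined_by \<alpha> \<gamma> \<and> refined_by \<beta> \<gamma>)"

lemma finite_open_covers_iff:
  "\<alpha> \<in> finite_open_covers X \<longleftrightarrow> finite (fst \<alpha>) \<and> snd \<alpha> \<in> extensional (fst \<alpha>) \<and>
     (\<forall>v\<in>fst \<alpha>. openin X (snd \<alpha> v)) \<and> (\<Union>v\<in>fst \<alpha>. snd \<alpha> v) = topspace X"
  by (cases \<alpha>) (auto simp: finite_open_covers_def PiE_iff)

lemma border_covers_iff:
  "\<alpha> \<in> border_covers X \<longleftrightarrow> finite (fst \<alpha>) \<and> snd \<alpha> \<in> extensional (fst \<alpha>) \<and>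
     (\<forall>v\<in>fst \<alpha>. openin X (snd \<alpha> v)) \<and> compactin X (topspace X - (\<Union>v\<in>fst \<alpha>. snd \<alpha> v))"
  by (cases \<alpha>) (auto simp: border_covers_def PiE_iff)

lemma directed_finite_open_covers: "directed_families (finite_open_covers X)"
  unfolding directed_families_def
proof (intro ballI)
  fix \<alpha> \<beta> assume "\<alpha> \<in> finite_open_covers X" "\<beta> \<in> finite_open_covers X"
  then have "meet_family \<alpha> \<beta> \<in> finite_open_covers X"
    unfolding finite_open_covers_iff Union_meet_family by (auto simp: meet_family_def)
  then show "\<exists>\<gamma>\<in>finite_open_covers X. refined_by \<alpha> \<gamma> \<and> refined_by \<beta> \<gamma>"
    using meet_family_refines by blast
qed

lemma directed_border_covers: "directed_families (border_covers X)"
  unfolding directed_families_def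
proof (intro ballI)
  fix \<alpha> \<beta> assume "\<alpha> \<in> border_covers X" "\<beta> \<in> border_covers X"
  \<comment> \<open>The set left uncovered by the meet is the union of the two uncovered sets, hence
    compact.\<close>
  then have "meet_family \<alpha> \<beta> \<in> border_covers X"
    unfolding border_covers_iff Union_meet_family
    by (auto simp: meet_family_def Diff_Int intro: compactin_Un)
  then show "\<exists>\<gamma>\<in>border_covers X. refined_by \<alpha> \<gamma> \<and> refined_by \<beta> \<gamma>"
    using meet_family_refines by blast
qed

text \<open>The class of \<open>z\<close> lies in the image of the restriction map, spelled out with
  cocycles and projections. The nerve of a restricted family is a subcomplex, so \<open>w\<close>
  can be pulled back along \<open>q\<close> directly.\<close>

definition cohomology_class_lifts ::
  "nat \<Rightarrow> ('g, 'm) monoid_scheme \<Rightarrow> 'a set \<Rightarrow> 'a indexed_family set \<Rightarrow> 'a indexed_family set \<Rightarrow>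
    'a indexed_family \<Rightarrow> (nat list \<Rightarrow> 'g) \<Rightarrow> bool" where
  "cohomology_class_lifts n G A C C' \<alpha> z \<longleftrightarrow>
     (\<exists>\<beta>\<in>C. \<exists>w\<in>cocycles n (nerve \<beta>) G. \<exists>\<gamma>\<in>C'. \<exists>p q.
        is_refinement_projection \<alpha> \<gamma> p \<and> is_refinement_projection (restrict_family A \<beta>) \<gamma> q \<and>
        cochain_map n (nerve \<gamma>) p z
          \<in> coboundaries n (nerve \<gamma>) G #>\<^bsub>cochain_group n (nerve \<gamma>) G\<^esub> cochain_map n (nerve \<gamma>) q w)"

section \<open>Surjectivity of restriction in terms of cocycles and refinements\<close>

context comm_group
begin

text \<open>Contiguity of any two projections frees the bonding map from the one selected by
  \<open>SOME\<close>.\<close>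

lemma bonding_map_eq:
  assumes "is_refinement_projection \<alpha> \<beta> p" "c \<in> carrier (nerve_cohomology n G \<alpha>)"
  shows "bonding_map n G \<alpha> \<beta> c = cohomology_map n G (nerve \<beta>) p c"
proof -
  have "is_refinement_projection \<alpha> \<beta> (SOME p. is_refinement_projection \<alpha> \<beta> p)"
    using assms(1) by (intro is_refinement_projection_some) (auto simp: refined_by_def)
  then show ?thesis
    unfolding bonding_map_def using assms
    by (intro cohomology_map_contiguous[where K = "nerve \<alpha>"] simplicial_complex_nerve
        contiguous_refinement_projections)
qed

lemma directed_system_nerve_cohomology:
  fixes C :: "'x indexed_family set"
  assumes "directed_families C"
  shows "directed_system C refined_by (nerve_cohomology n G) (bonding_map n G)"
proof
  fix \<alpha> \<beta> \<gamma> :: "'x indexed_family" and c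
  show "refined_by \<alpha> \<alpha>"
    using is_refinement_projection_id unfolding refined_by_def by blast
  show "refined_by \<alpha> \<gamma>" if "refined_by \<alpha> \<beta>" "refined_by \<beta> \<gamma>"
    using that is_refinement_projection_compose unfolding refined_by_def by blast
  show "\<exists>\<gamma>\<in>C. refined_by \<alpha> \<gamma> \<and> refined_by \<beta> \<gamma>" if "\<alpha> \<in> C" "\<beta> \<in> C"
    using assms that by (auto simp: directed_families_def)
  show "c \<otimes>\<^bsub>nerve_cohomology n G \<alpha>\<^esub> d \<in> carrier (nerve_cohomology n G \<alpha>)"
    if "c \<in> carrier (nerve_cohomology n G \<alpha>)" "d \<in> carrier (nerve_cohomology n G \<alpha>)" for d
    using that by (intro cohomology_mult_closed simplicial_complex_nerve)
  show "bonding_map n G \<alpha> \<beta> \<in> hom (nerve_cohomology n G \<alpha>) (nerve_cohomology n G \<beta>)"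
    if "refined_by \<alpha> \<beta>"
    unfolding bonding_map_def using is_refinement_projection_some[OF that]
    by (intro cohomology_map_hom simplicial_complex_nerve contiguous_refinement_projections)
  show "bonding_map n G \<beta> \<gamma> (bonding_map n G \<alpha> \<beta> c) = bonding_map n G \<alpha> \<gamma> c"
    if \<alpha>\<beta>: "refined_by \<alpha> \<beta>" and \<beta>\<gamma>: "refined_by \<beta> \<gamma>" and c: "c \<in> carrier (nerve_cohomology n G \<alpha>)"
  proof -
    obtain p q where p: "is_refinement_projection \<alpha> \<beta> p" and q: "is_refinement_projection \<beta> \<gamma> q"
      using \<alpha>\<beta> \<beta>\<gamma> by (auto simp: refined_by_def)
    have "cohomology_map n G (nerve \<beta>) p c \<in> carrier (nerve_cohomology n G \<beta>)"
      by (rule hom_in_carrier[OF cohomology_map_hom c])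
        (intro simplicial_complex_nerve contiguous_refinement_projections p)+
    then show ?thesis
      using p q c
      by (simp add: bonding_map_eq[OF p] bonding_map_eq[OF q]
          bonding_map_eq[OF is_refinement_projection_compose[OF p q]]
          cohomology_map_compose[where K = "nerve \<alpha>"] simplicial_complex_nerve
          contiguous_refinement_projections)
  qed
qed

lemma directed_system_map_restriction:
  fixes C C' :: "'x indexed_family set"
  assumes "directed_families C" "directed_families C'" "restrict_family A ` C \<subseteq> C'"
  shows "directed_system_map C refined_by (nerve_cohomology n G) (bonding_map n G)
    C' refined_by (nerve_cohomology n G) (bonding_map n G) (restrict_family A)
    (\<lambda>\<alpha>. cohomology_map n G (nerve (restrict_family A \<alpha>)) id)"
proof (intro directed_system_map.intro directed_system_nerve_cohomology assms
    directed_system_map_axioms.intro)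
  fix \<alpha> \<beta> :: "'x indexed_family" and c
  let ?R = "restrict_family A"
  note simps = simplicial_complex_nerve contiguous_refinement_projections
  have incl: "simplicial_map (nerve (?R \<alpha>)) (nerve \<alpha>) id" for \<alpha>
    by (intro contiguous_refinement_projections is_refinement_projection_restrict_id)
  show "?R \<alpha> \<in> C'" if "\<alpha> \<in> C"
    using assms(3) that by blast
  show "refined_by (?R \<alpha>) (?R \<beta>)" if "refined_by \<alpha> \<beta>"
    using that is_refinement_projection_restrict unfolding refined_by_def by blast
  show "cohomology_map n G (nerve (?R \<alpha>)) id \<in> hom (nerve_cohomology n G \<alpha>) (nerve_cohomology n G (?R \<alpha>))"
    by (intro cohomology_map_hom simplicial_complex_nerve incl)
  show "cohomology_map n G (nerve (?R \<beta>)) id (bonding_map n G \<alpha> \<beta> c)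
    = bonding_map n G (?R \<alpha>) (?R \<beta>) (cohomology_map n G (nerve (?R \<alpha>)) id c)"
    if \<alpha>\<beta>: "refined_by \<alpha> \<beta>" and c: "c \<in> carrier (nerve_cohomology n G \<alpha>)"
  proof -
    obtain p where p: "is_refinement_projection \<alpha> \<beta> p"
      using \<alpha>\<beta> by (auto simp: refined_by_def)
    note pR = is_refinement_projection_restrict[OF p, of A]
    have "cohomology_map n G (nerve (?R \<alpha>)) id c \<in> carrier (nerve_cohomology n G (?R \<alpha>))"
      by (rule hom_in_carrier[OF cohomology_map_hom c]) (intro simplicial_complex_nerve incl)+
    then show ?thesis
      using c by (simp add: bonding_map_eq[OF p] bonding_map_eq[OF pR] incl
          cohomology_map_compose[where K = "nerve \<alpha>"] simps p pR)
  qed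
qed

text \<open>Both quotients are unfolded: the direct limits by \<open>dirlim_map_epi_iff\<close>, the
  cohomology groups by equality of cosets.\<close>

lemma limit_restriction_epi_iff:
  fixes C C' :: "'x indexed_family set"
  assumes "directed_families C" "directed_families C'" "restrict_family A ` C \<subseteq> C'"
  shows "limit_restriction C' n G A \<in> epi (limit_cohomology C n G) (limit_cohomology C' n G) \<longleftrightarrow>
    (\<forall>\<alpha>\<in>C'. \<forall>z\<in>cocycles n (nerve \<alpha>) G. cohomology_class_lifts n G A C C' \<alpha> z)"
proof -
  let ?R = "restrict_family A"
  interpret directed_system_map C refined_by "nerve_cohomology n G" "bonding_map n G"
    C' refined_by "nerve_cohomology n G" "bonding_map n G" ?R
    "\<lambda>\<alpha>. cohomology_map n G (nerve (?R \<alpha>)) id"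
    by (rule directed_system_map_restriction[OF assms])
  have incl: "simplicial_map (nerve (?R \<alpha>)) (nerve \<alpha>) id" for \<alpha>
    by (intro contiguous_refinement_projections is_refinement_projection_restrict_id)
  let ?B = "\<lambda>\<alpha>. coboundaries n (nerve \<alpha>) G" and ?C = "\<lambda>\<alpha>. cochain_group n (nerve \<alpha>) G"
  have carrier_coset: "(?B \<alpha> #>\<^bsub>?C \<alpha>\<^esub> z) \<in> carrier (nerve_cohomology n G \<alpha>)"
    if "z \<in> cocycles n (nerve \<alpha>) G" for \<alpha> :: "'x indexed_family" and z
    using that by (simp add: carrier_cohomology_group)
  have bonding: "bonding_map n G \<alpha> \<gamma> (?B \<alpha> #>\<^bsub>?C \<alpha>\<^esub> z) = ?B \<gamma> #>\<^bsub>?C \<gamma>\<^esub> cochain_map n (nerve \<gamma>) p z"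
    if "is_refinement_projection \<alpha> \<gamma> p" "z \<in> cocycles n (nerve \<alpha>) G" 
    for \<alpha> \<gamma> :: "'x indexed_family" and p z
    unfolding bonding_map_eq[OF that(1) carrier_coset[OF that(2)]]
    by (intro cohomology_map_coset simplicial_complex_nerve contiguous_refinement_projections that
        cocycles_closed)
  \<comment> \<open>Valid for every choice of \<open>p\<close> and \<open>q\<close>, so that the
    existence of projections can be quantified together with the cohomology relation.\<close>
  have coset_eq_iff: "bonding_map n G \<alpha> \<gamma> (?B \<alpha> #>\<^bsub>?C \<alpha>\<^esub> z)
      = bonding_map n G (?R \<beta>) \<gamma> (cohomology_map n G (nerve (?R \<beta>)) id (?B \<beta> #>\<^bsub>?C \<beta>\<^esub> w)) \<longleftrightarrow>
      cochain_map n (nerve \<gamma>) p z \<in> ?B \<gamma> #>\<^bsub>?C \<gamma>\<^esub> cochain_map n (nerve \<gamma>) q w"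
    if p: "is_refinement_projection \<alpha> \<gamma> p" and q: "is_refinement_projection (?R \<beta>) \<gamma> q"
      and z: "z \<in> cocycles n (nerve \<alpha>) G" and w: "w \<in> cocycles n (nerve \<beta>) G"
    for \<alpha> \<beta> \<gamma> p q z w
  proof -
    let ?w = "cochain_map n (nerve (?R \<beta>)) id w"
    have "cohomology_map n G (nerve (?R \<beta>)) id (?B \<beta> #>\<^bsub>?C \<beta>\<^esub> w) = ?B (?R \<beta>) #>\<^bsub>?C (?R \<beta>)\<^esub> ?w"
      by (intro cohomology_map_coset simplicial_complex_nerve incl cocycles_closed w)
    moreover have w': "?w \<in> cocycles n (nerve (?R \<beta>)) G"
      by (intro cochain_map_cocycles[where K = "nerve \<beta>"] simplicial_complex_nerve incl w)
    moreover have qs: "simplicial_map (nerve \<gamma>) (nerve (?R \<beta>)) q" 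
      "simplicial_map (nerve \<gamma>) (nerve \<alpha>) p"
      by (intro contiguous_refinement_projections p q)+
    moreover have "cochain_map n (nerve \<gamma>) p z \<in> carrier (?C \<gamma>)"
      by (intro hom_in_carrier[OF cochain_map_hom[OF qs(2)]] cocycles_closed z)
    moreover have "cochain_map n (nerve \<gamma>) q ?w \<in> carrier (?C \<gamma>)"
      by (intro hom_in_carrier[OF cochain_map_hom[OF qs(1)]] cocycles_closed w')
    ultimately show ?thesis
      using coboundary_coset_eq_iff[OF simplicial_complex_nerve]
      by (simp add: bonding[OF p z] bonding[OF q w'] cochain_map_cochain_map
          del: carrier_cochain_group)
  qed
  have "((\<alpha>, ?B \<alpha> #>\<^bsub>?C \<alpha>\<^esub> z),
       (?R \<beta>, cohomology_map n G (nerve (?R \<beta>)) id (?B \<beta> #>\<^bsub>?C \<beta>\<^esub> w))) \<in> target.rel \<longleftrightarrow>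
      (\<exists>\<gamma>\<in>C'. \<exists>p q. is_refinement_projection \<alpha> \<gamma> p \<and> is_refinement_projection (?R \<beta>) \<gamma> q \<and>
        cochain_map n (nerve \<gamma>) p z \<in> ?B \<gamma> #>\<^bsub>?C \<gamma>\<^esub> cochain_map n (nerve \<gamma>) q w)"
    if "\<alpha> \<in> C'" "z \<in> cocycles n (nerve \<alpha>) G" "\<beta> \<in> C" "w \<in> cocycles n (nerve \<beta>) G" for \<alpha> z \<beta> w
  proof -
    have "(refined_by \<alpha> \<gamma> \<and> refined_by (?R \<beta>) \<gamma> \<and> bonding_map n G \<alpha> \<gamma> (?B \<alpha> #>\<^bsub>?C \<alpha>\<^esub> z)
        = bonding_map n G (?R \<beta>) \<gamma> (cohomology_map n G (nerve (?R \<beta>)) id (?B \<beta> #>\<^bsub>?C \<beta>\<^esub> w))) \<longleftrightarrow>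
      (\<exists>p q. is_refinement_projection \<alpha> \<gamma> p \<and> is_refinement_projection (?R \<beta>) \<gamma> q \<and>
        cochain_map n (nerve \<gamma>) p z \<in> ?B \<gamma> #>\<^bsub>?C \<gamma>\<^esub> cochain_map n (nerve \<gamma>) q w)" for \<gamma>
      unfolding refined_by_def using coset_eq_iff[OF _ _ that(2,4)] by blast
    then show ?thesis
      unfolding target.rel_iff
      using that(1,3) carrier_coset[OF that(2)] index_closed[OF that(3)]
        map_closed[OF that(3) carrier_coset[OF that(4)]] by simp
  qed
  then have "(\<exists>\<beta>\<in>C. \<exists>w\<in>cocycles n (nerve \<beta>) G. ((\<alpha>, ?B \<alpha> #>\<^bsub>?C \<alpha>\<^esub> z),
       (?R \<beta>, cohomology_map n G (nerve (?R \<beta>)) id (?B \<beta> #>\<^bsub>?C \<beta>\<^esub> w))) \<in> target.rel) \<longleftrightarrow>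
      cohomology_class_lifts n G A C C' \<alpha> z"
    if "\<alpha> \<in> C'" "z \<in> cocycles n (nerve \<alpha>) G" for \<alpha> z
    unfolding cohomology_class_lifts_def using that by (intro bex_cong) auto
  then show ?thesis
    unfolding limit_restriction_def limit_cohomology_def dirlim_map_epi_iff
      carrier_cohomology_group by simp
qed

text \<open>Contiguity of \<open>q'\<close> and \<open>q \<circ> r\<close> is required instead of equality because a shrunk cover of the
  whole space refines the given one only through a projection other than \<open>q \<circ> r\<close>.\<close>

lemma cohomology_class_lifts_transfer:
  assumes lifts: "cohomology_class_lifts n G A C C' \<alpha> (cochain_map n (nerve \<alpha>) id z)"
    and sub: "nerve \<alpha> \<subseteq> nerve \<alpha>'" and z: "z \<in> cocycles n (nerve \<alpha>') G"
    and step: "\<And>\<beta> \<gamma> p q. \<lbrakk>\<beta> \<in> C; \<gamma> \<in> C'; is_refinement_projection \<alpha> \<gamma> p;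
        is_refinement_projection (restrict_family A \<beta>) \<gamma> q\<rbrakk> \<Longrightarrow>
      \<exists>\<beta>'\<in>D. \<exists>\<gamma>'\<in>D'. \<exists>r q'. nerve \<beta>' \<subseteq> nerve \<beta> \<and> simplicial_map (nerve \<gamma>') (nerve \<gamma>) r \<and>
        is_refinement_projection \<alpha>' \<gamma>' (p \<circ> r) \<and>
        is_refinement_projection (restrict_family B \<beta>') \<gamma>' q' \<and>
        contiguous (nerve \<gamma>') (nerve \<beta>) q' (q \<circ> r)"
  shows "cohomology_class_lifts n G B D D' \<alpha>' z"
proof -
  obtain \<beta> w \<gamma> p q where \<beta>: "\<beta> \<in> C" and w: "w \<in> cocycles n (nerve \<beta>) G" and \<gamma>: "\<gamma> \<in> C'"
    and p: "is_refinement_projection \<alpha> \<gamma> p" and q: "is_refinement_projection (restrict_family A \<beta>) \<gamma> q"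
    and eq: "cochain_map n (nerve \<gamma>) p (cochain_map n (nerve \<alpha>) id z)
      \<in> coboundaries n (nerve \<gamma>) G #>\<^bsub>cochain_group n (nerve \<gamma>) G\<^esub> cochain_map n (nerve \<gamma>) q w"
    using lifts unfolding cohomology_class_lifts_def by blast
  obtain \<beta>' \<gamma>' r q' where \<beta>': "\<beta>' \<in> D" "nerve \<beta>' \<subseteq> nerve \<beta>" and \<gamma>': "\<gamma>' \<in> D'"
    and r: "simplicial_map (nerve \<gamma>') (nerve \<gamma>) r" and pr: "is_refinement_projection \<alpha>' \<gamma>' (p \<circ> r)"
    and q': "is_refinement_projection (restrict_family B \<beta>') \<gamma>' q'"
    and cont: "contiguous (nerve \<gamma>') (nerve \<beta>) q' (q \<circ> r)"
    using step[OF \<beta> \<gamma> p q] by blast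
  let ?B = "\<lambda>\<alpha>. coboundaries n (nerve \<alpha>) G" and ?C = "\<lambda>\<alpha>. cochain_group n (nerve \<alpha>) G"
  let ?m = "\<lambda>\<alpha>. cochain_map n (nerve \<alpha>)"
  have p': "simplicial_map (nerve \<gamma>) (nerve \<alpha>) p"
    by (intro contiguous_refinement_projections p)
  have "simplicial_map (nerve \<gamma>) (nerve (restrict_family A \<beta>)) q"
    by (intro contiguous_refinement_projections q)
  moreover have "simplicial_map (nerve (restrict_family A \<beta>)) (nerve \<beta>) id"
    by (intro contiguous_refinement_projections is_refinement_projection_restrict_id)
  \<comment> \<open>Composition with the inclusion of the restricted nerve turns \<open>q\<close>
    into a simplicial map to the nerve of \<open>\<beta>\<close> itself.\<close>
  ultimately have q\<beta>: "simplicial_map (nerve \<gamma>) (nerve \<beta>) q"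
    using simplicial_map_compose by fastforce
  have wc: "?m \<gamma> q w \<in> carrier (?C \<gamma>)"
    by (intro hom_in_carrier[OF cochain_map_hom[OF q\<beta>]] cocycles_closed w)
  obtain b where b: "b \<in> ?B \<gamma>" "?m \<gamma> p z = b \<otimes>\<^bsub>?C \<gamma>\<^esub> ?m \<gamma> q w"
    using eq by (auto simp: cochain_map_cochain_map[OF p'] r_coset_def)
  have bc: "b \<in> carrier (?C \<gamma>)"
    using subgroup.subset[OF subgroup_coboundaries[OF simplicial_complex_nerve]] b(1) by blast
  \<comment> \<open>The relation between \<open>z\<close> and \<open>w\<close> is pulled back along
    \<open>r\<close>; then \<open>q \<circ> r\<close> is replaced by the contiguous map
    \<open>q'\<close>.\<close>
  have "?m \<gamma>' (p \<circ> r) z = ?m \<gamma>' r (?m \<gamma> p z)"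
    by (simp add: cochain_map_cochain_map[OF r])
  also have "\<dots> = ?m \<gamma>' r b \<otimes>\<^bsub>?C \<gamma>'\<^esub> ?m \<gamma>' (q \<circ> r) w"
    unfolding b(2) hom_mult[OF cochain_map_hom[OF r] bc wc] cochain_map_cochain_map[OF r] ..
  finally have "?m \<gamma>' (p \<circ> r) z \<in> ?B \<gamma>' #>\<^bsub>?C \<gamma>'\<^esub> ?m \<gamma>' (q \<circ> r) w"
    using cochain_map_coboundaries[OF simplicial_complex_nerve r b(1)] by (auto simp: r_coset_def)
  moreover have "?m \<gamma>' (q \<circ> r) w \<in> ?B \<gamma>' #>\<^bsub>?C \<gamma>'\<^esub> ?m \<gamma>' q' w"
    by (intro contiguous_cohomologous[OF _ _ cont w] simplicial_complex_nerve)
  moreover have q'\<beta>: "simplicial_map (nerve \<gamma>') (nerve \<beta>') q'"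
  proof -
    have "simplicial_map (nerve \<gamma>') (nerve (restrict_family B \<beta>')) q'"
      by (intro contiguous_refinement_projections q')
    moreover have "simplicial_map (nerve (restrict_family B \<beta>')) (nerve \<beta>') id"
      by (intro contiguous_refinement_projections is_refinement_projection_restrict_id)
    ultimately show ?thesis
      using simplicial_map_compose by fastforce
  qed
  \<comment> \<open>The lifting witness over \<open>D\<close> is the restriction of \<open>w\<close>
    to the smaller nerve of \<open>\<beta>'\<close>.\<close>
  moreover have w': "?m \<beta>' id w \<in> cocycles n (nerve \<beta>') G"
    by (intro cochain_map_cocycles[OF _ _ w] simplicial_complex_nerve simplicial_map_id \<beta>')
  moreover have "?m \<gamma>' q' (?m \<beta>' id w) = ?m \<gamma>' q' w"
    by (simp add: cochain_map_cochain_map[OF q'\<beta>])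
  moreover have "?m \<gamma>' q' (?m \<beta>' id w) \<in> carrier (?C \<gamma>')"
    by (intro hom_in_carrier[OF cochain_map_hom[OF q'\<beta>]] cocycles_closed w')
  ultimately have "?m \<gamma>' (p \<circ> r) z \<in> ?B \<gamma>' #>\<^bsub>?C \<gamma>'\<^esub> ?m \<gamma>' q' (?m \<beta>' id w)"
    using group.repr_independence[OF group_cochain_group _ _ subgroup_coboundaries[OF simplicial_complex_nerve]]
    by metis
  then show ?thesis
    unfolding cohomology_class_lifts_def using \<beta>' \<gamma>' pr q' w' by blast
qed

end

section \<open>Compactifications separating disjoint closed sets\<close>

text \<open>The features of the Stone-Cech compactification on which the argument rests. Disjoint
  closures of disjoint closed sets also force \<open>e\<close> to be an embedding.\<close>

locale normal_compactification =
  fixes X :: "'a topology" and Z :: "'b topology" and e :: "'a \<Rightarrow> 'b"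
  assumes metrizable: "metrizable_space X"
    and compact_Z: "compact_space Z" and Hausdorff_Z: "Hausdorff_space Z"
    and continuous_e: "continuous_map X Z e"
    and dense: "Z closure_of (e ` topspace X) = topspace Z"
    and separates: "\<lbrakk>closedin X A; closedin X B; disjnt A B\<rbrakk> \<Longrightarrow>
      disjnt (Z closure_of (e ` A)) (Z closure_of (e ` B))"
begin

abbreviation cl :: "'a set \<Rightarrow> 'b set" where "cl S \<equiv> Z closure_of (e ` S)"

abbreviation remainder :: "'b set" where "remainder \<equiv> topspace Z - e ` topspace X"

definition pre :: "'b set \<Rightarrow> 'a set" where "pre W = {x \<in> topspace X. e x \<in> W}"

text \<open>Relative compactness in \<open>X\<close>, expressed in the compactification.\<close>

definition small :: "'a set \<Rightarrow> bool" where
  "small S \<longleftrightarrow> S \<subseteq> topspace X \<and> cl S \<subseteq> e ` topspace X"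

lemma e_in_Z: "x \<in> topspace X \<Longrightarrow> e x \<in> topspace Z"
  using continuous_e by (auto simp: continuous_map_def)

lemma pre_subset: "pre W \<subseteq> topspace X"
  by (auto simp: pre_def)

lemma openin_pre: "openin Z W \<Longrightarrow> openin X (pre W)"
  unfolding pre_def by (rule openin_continuous_map_preimage[OF continuous_e])

lemma closedin_pre: "closedin Z W \<Longrightarrow> closedin X (pre W)"
  unfolding pre_def by (rule closedin_continuous_map_preimage[OF continuous_e])

lemma closedin_cl: "closedin Z (cl S)"
  by simp

lemma cl_mono: "S \<subseteq> T \<Longrightarrow> cl S \<subseteq> cl T"
  by (intro closure_of_mono image_mono)

lemma cl_Un: "cl (S \<union> T) = cl S \<union> cl T"
  by (simp add: image_Un)

lemma e_in_cl: "x \<in> S \<Longrightarrow> S \<subseteq> topspace X \<Longrightarrow> e x \<in> cl S"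
  using closure_of_subset[of "e ` S" Z] e_in_Z by blast

lemma closedin_singleton: "x \<in> topspace X \<Longrightarrow> closedin X {x}"
  using metrizable_imp_Hausdorff_space[OF metrizable] by (simp add: closedin_Hausdorff_sing_eq)

text \<open>Points are closed, so \<open>separates\<close> applies to \<open>{x}\<close> and
  \<open>S\<close>.\<close>

lemma in_closed_if_e_in_cl:
  assumes "closedin X S" "x \<in> topspace X" "e x \<in> cl S"
  shows "x \<in> S"
proof (rule ccontr)
  assume "x \<notin> S"
  then have "disjnt (cl {x}) (cl S)"
    by (intro separates[OF closedin_singleton[OF assms(2)] assms(1)]) simp
  moreover have "e x \<in> cl {x}"
    by (rule e_in_cl) (use assms in auto)
  ultimately show False
    using assms(3) unfolding disjnt_iff by blast
qed

lemma inj_on_e: "inj_on e (topspace X)"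
proof (rule inj_onI)
  fix x y assume "x \<in> topspace X" "y \<in> topspace X" "e x = e y"
  then have "x \<in> {y}"
    using in_closed_if_e_in_cl[OF closedin_singleton] e_in_cl[of y "{y}"] by simp
  then show "x = y" by simp
qed

text \<open>A neighbourhood of a point of \<open>W\<close> can be shrunk inside \<open>W\<close> and
  still meets the dense image of \<open>X\<close>.\<close>

lemma cl_pre_dense:
  assumes "openin Z W"
  shows "W \<subseteq> cl (pre W)"
proof
  fix y assume y: "y \<in> W"
  have "y \<in> cl (topspace X)"
    using y openin_subset[OF assms] dense by blast
  show "y \<in> cl (pre W)"
    unfolding in_closure_of
  proof (intro conjI allI impI)
    show "y \<in> topspace Z"
      using y assms openin_subset by blast
    fix T assume "y \<in> T \<and> openin Z T"
    then have "openin Z (T \<inter> W)" "y \<in> T \<inter> W"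
      using y assms by auto
    then obtain x where "x \<in> topspace X" "e x \<in> T \<inter> W"
      using \<open>y \<in> cl (topspace X)\<close> unfolding in_closure_of by blast
    then show "\<exists>z. z \<in> e ` pre W \<and> z \<in> T"
      by (auto simp: pre_def)
  qed
qed

text \<open>The image of a closed set is the trace of its closure on the image of \<open>X\<close>,
  so \<open>e\<close> is a closed map onto its image.\<close>

lemma homeomorphic_map_e: "homeomorphic_map X (subtopology Z (e ` topspace X)) e"
proof (rule bijective_closed_imp_homeomorphic_map)
  show "continuous_map X (subtopology Z (e ` topspace X)) e"
    using continuous_e by (simp add: continuous_map_in_subtopology)
  show "e ` topspace X = topspace (subtopology Z (e ` topspace X))"
    using e_in_Z by auto
  show "closed_map X (subtopology Z (e ` topspace X)) e"
    unfolding closed_map_def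
  proof (intro allI impI)
    fix S assume S: "closedin X S"
    then have "e ` S = cl S \<inter> e ` topspace X"
      using in_closed_if_e_in_cl[OF S] e_in_cl[of _ S] closedin_subset[OF S] by auto
    then show "closedin (subtopology Z (e ` topspace X)) (e ` S)"
      unfolding closedin_subtopology using closedin_cl by metis
  qed
qed (rule inj_on_e)

lemma compactin_pre:
  assumes "closedin Z L" "L \<subseteq> e ` topspace X"
  shows "compactin X (pre L)"
proof -
  have "e ` pre L = L"
    using assms(2) by (auto simp: pre_def)
  moreover have "compactin (subtopology Z (e ` topspace X)) L"
    using assms closedin_compact_space[OF compact_Z] by (simp add: compactin_subtopology)
  ultimately show ?thesis
    using homeomorphic_map_compactness[OF homeomorphic_map_e pre_subset] by metis
qed

lemma small_subset: "small T \<Longrightarrow> S \<subseteq> T \<Longrightarrow> small S"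
  unfolding small_def using cl_mono by (meson subset_trans)

lemma small_Un: "small S \<Longrightarrow> small T \<Longrightarrow> small (S \<union> T)"
  by (simp add: small_def cl_Un del: closure_of_Un)

lemma small_empty: "small {}"
  by (simp add: small_def)

lemma small_UN: "finite I \<Longrightarrow> (\<And>i. i \<in> I \<Longrightarrow> small (F i)) \<Longrightarrow> small (\<Union>i\<in>I. F i)"
  by (induction I rule: finite_induct) (auto simp: small_empty intro: small_Un)

lemma smallI: "S \<subseteq> topspace X \<Longrightarrow> closedin Z L \<Longrightarrow> e ` S \<subseteq> L \<Longrightarrow> L \<subseteq> e ` topspace X \<Longrightarrow> small S"
  unfolding small_def using closure_of_minimal[of "e ` S" L Z] by blast

lemma smallI': "S \<subseteq> topspace X \<Longrightarrow> cl S \<inter> remainder = {} \<Longrightarrow> small S"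
  unfolding small_def using closure_of_subset_topspace[of Z "e ` S"] by blast

text \<open>A closed set is the preimage of its closure in \<open>Z\<close>, and for a small set
  this closure is compact inside the image of \<open>X\<close>.\<close>

lemma compactin_small:
  assumes "closedin X S" "small S"
  shows "compactin X S"
proof -
  have "S = pre (cl S)"
    using in_closed_if_e_in_cl[OF assms(1)] e_in_cl closedin_subset[OF assms(1)]
    by (auto simp: pre_def)
  then show ?thesis
    using compactin_pre[of "cl S"] assms(2) by (auto simp: small_def)
qed

lemma compactin_image_closed: "compactin X K \<Longrightarrow> closedin Z (e ` K)"
  using compactin_imp_closedin[OF Hausdorff_Z] image_compactin[OF _ continuous_e] by blast

lemma compactin_imp_small: "compactin X K \<Longrightarrow> small K"
  using compactin_image_closed[of K] compactin_subset_topspace[of X K]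
  by (intro smallI[where L = "e ` K"]) auto

lemma small_closure:
  assumes "small S"
  shows "small (X closure_of S)"
proof (rule smallI[where L = "cl S"])
  show "e ` (X closure_of S) \<subseteq> cl S"
    by (rule continuous_map_image_closure_subset[OF continuous_e])
qed (use assms in \<open>auto simp: small_def closure_of_subset_topspace\<close>)

text \<open>If \<open>p\<close> avoids \<open>cl (A \<inter> B)\<close>, so does a closed
  neighbourhood \<open>N\<close> of \<open>p\<close>. Cutting \<open>A\<close> and \<open>B\<close>
  down to \<open>N\<close> makes them disjoint without removing \<open>p\<close> from either
  closure, contrary to \<open>separates\<close>.\<close>

lemma cl_Int:
  assumes A: "closedin X A" and B: "closedin X B"
  shows "cl A \<inter> cl B \<subseteq> cl (A \<inter> B)"
proof
  fix p assume p: "p \<in> cl A \<inter> cl B"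
  have pZ: "p \<in> topspace Z"
    using p closure_of_subset_topspace[of Z "e ` A"] by blast
  show "p \<in> cl (A \<inter> B)"
  proof (rule ccontr)
    assume not: "p \<notin> cl (A \<inter> B)"
    have "regular_space Z"
      using compact_Hausdorff_imp_regular_space compact_Z Hausdorff_Z by blast
    moreover have "p \<in> topspace Z - cl (A \<inter> B)" "openin Z (topspace Z - cl (A \<inter> B))"
      using pZ not by auto
    ultimately obtain U N where N: "openin Z U" "closedin Z N" "p \<in> U" "U \<subseteq> N" "N \<subseteq> topspace Z - cl (A \<inter> B)"
      unfolding neighbourhood_base_of_closedin[symmetric] neighbourhood_base_of by metis
    have cl_near: "p \<in> cl (S \<inter> pre N)" if "p \<in> cl S" "S \<subseteq> topspace X" for S
      unfolding in_closure_of
    proof (intro conjI allI impI)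
      show "p \<in> topspace Z"
        by (rule pZ)
      fix T assume "p \<in> T \<and> openin Z T"
      then have "openin Z (T \<inter> U)" "p \<in> T \<inter> U"
        using N by auto
      moreover have "\<forall>T. p \<in> T \<and> openin Z T \<longrightarrow> (\<exists>y. y \<in> e ` S \<and> y \<in> T)"
        using that(1) unfolding in_closure_of by simp
      ultimately obtain y where "y \<in> e ` S" "y \<in> T \<inter> U"
        by meson
      then show "\<exists>y. y \<in> e ` (S \<inter> pre N) \<and> y \<in> T"
        using N that(2) by (auto simp: pre_def)
    qed
    have "disjnt (A \<inter> pre N) (B \<inter> pre N)"
      unfolding disjnt_iff
    proof (intro allI notI)
      fix x assume "x \<in> A \<inter> pre N \<and> x \<in> B \<inter> pre N"
      then have "e x \<in> cl (A \<inter> B)" "e x \<in> N"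
        using closedin_subset[OF A] by (auto simp: pre_def intro!: e_in_cl)
      then show False
        using N by blast
    qed
    then have "disjnt (cl (A \<inter> pre N)) (cl (B \<inter> pre N))"
      using A B closedin_pre[OF N(2)] by (intro separates closedin_Int)
    moreover have "p \<in> cl (A \<inter> pre N)" "p \<in> cl (B \<inter> pre N)"
      using p closedin_subset[OF A] closedin_subset[OF B] by (auto intro: cl_near)
    ultimately show False
      by (auto simp: disjnt_iff)
  qed
qed

text \<open>The factor \<open>A\<close> takes care of the empty index set, where the bare
  intersection would be \<open>UNIV\<close>.\<close>

lemma cl_INT:
  assumes "finite V" "closedin X A" "\<And>v. v \<in> V \<Longrightarrow> closedin X (F v)"
  shows "cl A \<inter> (\<Inter>v\<in>V. cl (F v)) \<subseteq> cl (A \<inter> (\<Inter>v\<in>V. F v))"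
  using assms
proof (induction V)
  case (insert v V)
  have "closedin X (A \<inter> (\<Inter>v\<in>V. F v))"
  proof (cases "V = {}")
    case False
    then show ?thesis
      using insert by (intro closedin_Int closedin_INT) auto
  qed (use insert in simp)
  then have "cl (F v) \<inter> cl (A \<inter> (\<Inter>v\<in>V. F v)) \<subseteq> cl (F v \<inter> (A \<inter> (\<Inter>v\<in>V. F v)))"
    using insert by (intro cl_Int) auto
  moreover have "cl A \<inter> (\<Inter>v\<in>V. cl (F v)) \<subseteq> cl (A \<inter> (\<Inter>v\<in>V. F v))"
    using insert by auto
  moreover have "F v \<inter> (A \<inter> (\<Inter>v\<in>V. F v)) = A \<inter> (\<Inter>v\<in>insert v V. F v)"
    by blast
  ultimately show ?case
    by auto
qed simp

text \<open>\<open>U n\<close> is the largest open set of \<open>Z\<close> whose trace on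
  \<open>X\<close> is the neighbourhood of \<open>K\<close> of radius
  \<open>inverse (Suc n)\<close>. By compactness these neighbourhoods eventually enter any open set
  around \<open>K\<close>, so no point outside \<open>K\<close> lies in all
  \<open>U n\<close>.\<close>

lemma closed_in_X_G_delta:
  assumes K: "closedin Z K" "K \<subseteq> e ` topspace X"
  obtains U :: "nat \<Rightarrow> 'b set" where "\<And>n. openin Z (U n)" "(\<Inter>n. U n) = K"
proof -
  obtain M d where M: "Metric_space M d" and X: "X = Metric_space.mtopology M d"
    using metrizable unfolding metrizable_space_def by blast
  interpret Metric_space M d by (rule M)
  have topX: "topspace X = M"
    using X by simp
  let ?B = "\<lambda>n. \<Union>x\<in>pre K. mball x (inverse (Suc n))"
  define U where "U = (\<lambda>n. topspace Z - cl (topspace X - ?B n))"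
  have openB: "openin X (?B n)" for n
    unfolding X by (intro openin_Union) auto
  have openU: "openin Z (U n)" for n
    unfolding U_def by (intro openin_diff) auto
  have KU: "K \<subseteq> U n" for n
  proof
    fix y assume y: "y \<in> K"
    then obtain x where x: "y = e x" "x \<in> topspace X"
      using K(2) by blast
    then have "x \<in> ?B n"
      using y topX by (auto simp: pre_def intro!: bexI[of _ x])
    then have "e x \<notin> cl (topspace X - ?B n)"
      using in_closed_if_e_in_cl[of "topspace X - ?B n" x] x openB by blast
    then show "y \<in> U n"
      using x e_in_Z by (auto simp: U_def)
  qed
  have UK: "y \<in> K" if y: "\<And>n. y \<in> U n" for y
  proof (rule ccontr)
    assume "y \<notin> K"
    have yZ: "y \<in> topspace Z"
      using y[of 0] by (simp add: U_def)
    have "compactin Z K" "compactin Z {y}"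
      using closedin_compact_space[OF compact_Z K(1)] yZ by auto
    then obtain P Q where PQ: "openin Z P" "openin Z Q" "K \<subseteq> P" "{y} \<subseteq> Q" "disjnt P Q"
      using Hausdorff_space_compact_separation[OF Hausdorff_Z] \<open>y \<notin> K\<close>
      by (metis disjnt_insert1 disjnt_empty1 disjnt_sym)
    \<comment> \<open>A Lebesgue number for the cover by the single open set \<open>pre P\<close>
      gives one radius valid at all points of the compact set.\<close>
    have "\<exists>\<epsilon>>0. \<forall>x\<in>pre K. \<exists>U\<in>{pre P}. mball x \<epsilon> \<subseteq> U"
      using compactin_pre[OF K] openin_pre[OF PQ(1)] PQ(3)
      by (intro lebesgue_number) (auto simp: X[symmetric] pre_def)
    then obtain \<epsilon> where \<epsilon>: "\<epsilon> > 0" "\<And>x. x \<in> pre K \<Longrightarrow> mball x \<epsilon> \<subseteq> pre P"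
      by blast
    obtain n where "inverse (Suc n) < \<epsilon>"
      using reals_Archimedean \<epsilon>(1) by auto
    then have "mball x (inverse (Suc n)) \<subseteq> pre P" if "x \<in> pre K" for x
      using \<epsilon>(2)[OF that] mball_subset_concentric[of "inverse (Suc n)" \<epsilon> x] by auto
    \<comment> \<open>The ball neighbourhood lies in \<open>pre P\<close>, so the trace of
      \<open>Q\<close> lies in its complement, whose closure then contains \<open>y\<close>.\<close>
    then have "pre Q \<subseteq> topspace X - ?B n"
      using PQ(5) by (fastforce simp: pre_def disjnt_iff)
    then have "cl (pre Q) \<subseteq> cl (topspace X - ?B n)"
      by (rule cl_mono)
    then have "y \<in> cl (topspace X - ?B n)"
      using cl_pre_dense[OF PQ(2)] PQ(4) by blast
    then show False
      using y[of n] by (simp add: U_def)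
  qed
  have "(\<Inter>n. U n) = K"
    using KU UK by (intro subset_antisym subsetI) (simp_all add: subset_iff)
  with openU show thesis
    by (rule that)
qed

text \<open>The complement of a closed G-delta in a compact space is a countable union of compact
  sets, hence Lindelof, and a regular Lindelof space is normal.\<close>

lemma normal_complement:
  assumes K: "closedin Z K" "K \<subseteq> e ` topspace X"
  shows "normal_space (subtopology Z (topspace Z - K))"
proof (rule regular_Lindelof_imp_normal_space)
  show "regular_space (subtopology Z (topspace Z - K))"
    by (intro regular_space_subtopology compact_Hausdorff_imp_regular_space compact_Z Hausdorff_Z)
  obtain U :: "nat \<Rightarrow> 'b set" where U: "\<And>n. openin Z (U n)" "(\<Inter>n. U n) = K"
    using closed_in_X_G_delta[OF K] by blast
  have "Lindelof_space (subtopology Z (\<Union>(range (\<lambda>n. topspace Z - U n))))"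
  proof (rule Lindelof_space_Union)
    fix L assume "L \<in> range (\<lambda>n. topspace Z - U n)"
    then have "compactin Z L"
      using U(1) by (auto intro!: closedin_compact_space[OF compact_Z] closedin_diff)
    then show "Lindelof_space (subtopology Z L)"
      by (intro compact_imp_Lindelof_space compact_space_subtopology)
  qed auto
  moreover have "\<Union>(range (\<lambda>n. topspace Z - U n)) = topspace Z - K"
    using U(2) by blast
  ultimately show "Lindelof_space (subtopology Z (topspace Z - K))"
    by simp
qed

text \<open>Once the overlap, a closed set inside the image of \<open>X\<close>, is deleted, the two
  differences are disjoint and closed in a normal open subspace.\<close>

lemma separation_modulo_X:
  assumes C: "closedin Z C" and T: "closedin Z T" and CT: "C \<inter> T \<subseteq> e ` topspace X"
  obtains P Q where "openin Z P" "openin Z Q" "disjnt P Q" "C - T \<subseteq> P" "T - C \<subseteq> Q"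
proof -
  let ?K = "C \<inter> T"
  let ?W = "subtopology Z (topspace Z - ?K)"
  have K: "closedin Z ?K"
    using C T by blast
  have "closedin ?W (C - T)" "closedin ?W (T - C)"
    unfolding closedin_subtopology using C T closedin_subset[OF C] closedin_subset[OF T]
    by (blast intro: exI[of _ C] exI[of _ T])+
  moreover have "disjnt (C - T) (T - C)"
    by (auto simp: disjnt_iff)
  ultimately obtain P Q where "openin ?W P" "openin ?W Q" "C - T \<subseteq> P" "T - C \<subseteq> Q" "disjnt P Q"
    using normal_complement[OF K CT] unfolding normal_space_def by metis
  moreover have "openin Z P" if "openin ?W P" for P
    using that K openin_open_subtopology[of Z "topspace Z - ?K"] by blast
  ultimately show thesis
    using that by blast
qed

text \<open>The shrinking lemma with points of \<open>X\<close> ignored, both in the inclusion of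
  closures and in the covering. The sets are treated one at a time: \<open>W a\<close> is replaced
  by an open \<open>P\<close> around the part of \<open>C\<close> that the others miss, up to points
  of \<open>X\<close>.\<close>

lemma shrink:
  assumes "finite V" "closedin Z C" "\<And>v. v \<in> V \<Longrightarrow> openin Z (W v)"
    and "C - (\<Union>v\<in>V. W v) \<subseteq> e ` topspace X"
  shows "\<exists>W'. (\<forall>v\<in>V. openin Z (W' v) \<and> Z closure_of (W' v) \<inter> remainder \<subseteq> W v) \<and>
    C - (\<Union>v\<in>V. W' v) \<subseteq> e ` topspace X"
  using assms
proof (induction V arbitrary: C)
  case (insert a V)
  let ?C = "C - (\<Union>v\<in>V. W v)" and ?T = "topspace Z - W a"
  have C: "closedin Z ?C"
    using insert.prems by (intro closedin_diff openin_Union) auto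
  have T: "closedin Z ?T"
    using insert.prems by (intro closedin_diff) auto
  have CT: "?C \<inter> ?T \<subseteq> e ` topspace X"
    using insert.prems by blast
  obtain P Q where PQ: "openin Z P" "openin Z Q" "disjnt P Q" "?C - ?T \<subseteq> P" "?T - ?C \<subseteq> Q"
    using separation_modulo_X[OF C T CT] .
  \<comment> \<open>A point of the remainder outside \<open>W a\<close> lies in \<open>?T\<close>
    but not in \<open>?C\<close>, hence in the open set \<open>Q\<close>, which is disjoint from
    \<open>P\<close>.\<close>
  have P: "Z closure_of P \<inter> remainder \<subseteq> W a"
  proof
    fix y assume y: "y \<in> Z closure_of P \<inter> remainder"
    show "y \<in> W a"
    proof (rule ccontr)
      assume "y \<notin> W a"
      then have "y \<in> Q"
        using y PQ(5) CT by blast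
      then show False
        using y PQ(2,3) by (auto simp: in_closure_of disjnt_iff)
    qed
  qed
  have "closedin Z (C - P)"
    using insert.prems PQ by blast
  \<comment> \<open>Whatever the remaining sets miss in \<open>C - P\<close> lies in
    \<open>?C \<inter> ?T\<close>.\<close>
  moreover have "(C - P) - (\<Union>v\<in>V. W v) \<subseteq> e ` topspace X"
    using PQ(4) CT by blast
  ultimately obtain W' where W': "\<forall>v\<in>V. openin Z (W' v) \<and> Z closure_of (W' v) \<inter> remainder \<subseteq> W v"
    "(C - P) - (\<Union>v\<in>V. W' v) \<subseteq> e ` topspace X"
    using insert.IH[of "C - P"] insert.prems by auto
  have "C - (\<Union>v\<in>insert a V. (W'(a := P)) v) \<subseteq> e ` topspace X"
    using W'(2) insert.hyps by (auto split: if_splits)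
  moreover have "\<forall>v\<in>insert a V. openin Z ((W'(a := P)) v) \<and> Z closure_of ((W'(a := P)) v) \<inter> remainder \<subseteq> W v"
    using W'(1) P PQ(1) by simp
  ultimately show ?case
    by blast
qed auto

end

section \<open>The Stone-Cech compactification of a metrizable space\<close>

lemma normal_compactification_stone_cech:
  assumes "metrizable_space X"
  shows "normal_compactification X (stone_cech X) (stone_cech_embedding X)"
proof
  let ?Q = "unit_cube X" and ?Z = "stone_cech X" and ?e = "stone_cech_embedding X"
  let ?S = "?Q closure_of (?e ` topspace X)"
  have compQ: "compact_space ?Q"
    unfolding unit_cube_def compact_space_product_topology
    by (simp add: compact_space_subtopology)
  have HausQ: "Hausdorff_space ?Q"
    unfolding unit_cube_def Hausdorff_space_product_topology
    by (simp add: Hausdorff_space_subtopology)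
  have cont: "continuous_map X ?Q ?e"
    unfolding unit_cube_def continuous_map_componentwise
    by (auto simp: stone_cech_embedding_def unit_functions_def)
  show "metrizable_space X" by fact
  show "compact_space ?Z"
    unfolding stone_cech_def
    by (intro compact_space_subtopology closedin_compact_space[OF compQ]) simp
  show "Hausdorff_space ?Z"
    unfolding stone_cech_def by (intro Hausdorff_space_subtopology HausQ)
  have eQ: "?e ` topspace X \<subseteq> topspace ?Q"
    using cont by (auto simp: continuous_map_def)
  then have eS: "?e ` topspace X \<subseteq> ?S"
    by (rule closure_of_subset)
  then show "continuous_map X ?Z ?e"
    unfolding stone_cech_def using cont by (auto simp: continuous_map_in_subtopology)
  show "?Z closure_of (?e ` topspace X) = topspace ?Z"
    unfolding stone_cech_def using eS
    by (simp add: closure_of_subtopology closure_of_subset_topspace inf.absorb1 inf.absorb2)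
  show "disjnt (?Z closure_of (?e ` A)) (?Z closure_of (?e ` B))"
    if A: "closedin X A" and B: "closedin X B" and AB: "disjnt A B" for A B
  proof -
    \<comment> \<open>A Urysohn function for \<open>A\<close> and \<open>B\<close> is a coordinate
      of the cube; this coordinate is constantly 0 on one closure and 1 on the other.\<close>
    obtain g :: "'a \<Rightarrow> real" where g: "continuous_map X (top_of_set {0..1}) g" "g ` A \<subseteq> {0}" "g ` B \<subseteq> {1}"
      using Urysohn_lemma[OF metrizable_imp_normal_space[OF assms] A B AB, of 0 1] by auto
    \<comment> \<open>Coordinates of the cube are indexed by extensional functions.\<close>
    define f where "f = restrict g (topspace X)"
    have f: "f \<in> unit_functions X"
      unfolding unit_functions_def f_def using g(1) by (auto elim: continuous_map_eq)
    have "continuous_map ?Q (top_of_set {0..1}) (\<lambda>p. p f)"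
      unfolding unit_cube_def using continuous_map_product_projection[OF f] by fast
    then have coord: "continuous_map ?Q euclideanreal (\<lambda>p. p f)"
      by (simp add: continuous_map_in_subtopology)
    then have "closedin ?Q {p \<in> topspace ?Q. p f \<in> {c}}" for c
      by (intro closedin_continuous_map_preimage) auto
    moreover have "?e ` S \<subseteq> {p \<in> topspace ?Q. p f \<in> {c}}" if "g ` S \<subseteq> {c}" "S \<subseteq> topspace X" for S c
    proof (intro image_subsetI CollectI conjI)
      fix x assume "x \<in> S"
      then have x: "x \<in> topspace X" "g x = c"
        using that by auto
      then show "?e x \<in> topspace ?Q"
        using eQ by blast
      show "?e x f \<in> {c}"
        using f x by (simp add: stone_cech_embedding_def f_def)
    qed
    ultimately have "?Q closure_of (?e ` S) \<subseteq> {p \<in> topspace ?Q. p f \<in> {c}}"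
      if "g ` S \<subseteq> {c}" "S \<subseteq> topspace X" for S c
      using that by (intro closure_of_minimal) auto
    from this[OF g(2)] this[OF g(3)] have "disjnt (?Q closure_of (?e ` A)) (?Q closure_of (?e ` B))"
      using closedin_subset[OF A] closedin_subset[OF B] by (fastforce simp: disjnt_iff)
    then show ?thesis
      unfolding stone_cech_def using closure_of_subtopology_subset[of ?Q ?S "?e ` A"]
        closure_of_subtopology_subset[of ?Q ?S "?e ` B"] unfolding disjnt_iff by blast
  qed
qed

section \<open>Border covers and open covers of the remainder\<close>

lemma restrict_finite_open_covers:
  "restrict_family B ` finite_open_covers Y \<subseteq> finite_open_covers (subtopology Y B)"
  by (auto simp: finite_open_covers_iff restrict_family_def intro!: openin_subtopology_Int)

lemma restrict_border_covers:
  assumes "closedin X A"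
  shows "restrict_family A ` border_covers X \<subseteq> border_covers (subtopology X A)"
proof (rule image_subsetI)
  fix \<alpha> assume \<alpha>: "\<alpha> \<in> border_covers X"
  have "topspace (subtopology X A) - (\<Union>v\<in>fst \<alpha>. snd (restrict_family A \<alpha>) v)
      = A \<inter> (topspace X - (\<Union>v\<in>fst \<alpha>. snd \<alpha> v))"
    using closedin_subset[OF assms] by (auto simp: restrict_family_def)
  moreover have "compactin X (A \<inter> (topspace X - (\<Union>v\<in>fst \<alpha>. snd \<alpha> v)))"
    using \<alpha> assms by (intro closed_Int_compactin) (auto simp: border_covers_iff)
  ultimately show "restrict_family A \<alpha> \<in> border_covers (subtopology X A)"
    using \<alpha> by (auto simp: border_covers_iff restrict_family_def compactin_subtopology
        intro!: openin_subtopology_Int)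
qed

lemma finite_open_cover_subtopology:
  assumes "\<gamma> \<in> finite_open_covers (subtopology Z B)"
  shows "\<exists>W. \<forall>v\<in>fst \<gamma>. openin Z (W v) \<and> snd \<gamma> v = W v \<inter> B"
proof -
  have "\<forall>v\<in>fst \<gamma>. \<exists>U. openin Z U \<and> snd \<gamma> v = U \<inter> B"
    using assms by (auto simp: finite_open_covers_iff openin_subtopology)
  then show ?thesis
    by (rule bchoice)
qed

section \<open>Traces on the remainder and border covers obtained by deletion\<close>

context normal_compactification
begin

text \<open>For \<open>A = topspace X\<close> the set \<open>topspace Z - cl (A - U)\<close> is the largest open subset of \<open>Z\<close> whose
  trace on \<open>X\<close> is the open set \<open>U\<close>.\<close>

definition trace_family :: "'a set \<Rightarrow> 'b set \<Rightarrow> 'a indexed_family \<Rightarrow> 'b indexed_family" where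
  "trace_family A B \<delta> = (fst \<delta>, \<lambda>v\<in>fst \<delta>. (topspace Z - cl (A - snd \<delta> v)) \<inter> B)"

text \<open>\<open>S\<close> gathers the points to be discarded. Its closure is removed so that the
  sets stay open, and it is still small if \<open>S\<close> is.\<close>

definition border_family :: "'a set \<Rightarrow> (nat \<Rightarrow> 'a set) \<Rightarrow> 'a set \<Rightarrow> nat set \<Rightarrow> 'a indexed_family" where
  "border_family A U S V = (V, \<lambda>v\<in>V. U v \<inter> A - X closure_of S)"

lemma fst_trace_family [simp]: "fst (trace_family A B \<delta>) = fst \<delta>"
  by (simp add: trace_family_def)

lemma fst_border_family [simp]: "fst (border_family A U S V) = V"
  by (simp add: border_family_def)

lemma trace_family_mem_iff:
  "v \<in> fst \<delta> \<Longrightarrow> y \<in> snd (trace_family A B \<delta>) v \<longleftrightarrow> y \<in> topspace Z \<and> y \<notin> cl (A - snd \<delta> v) \<and> y \<in> B"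
  by (auto simp: trace_family_def)

lemma border_family_memD:
  assumes "v \<in> V" "x \<in> snd (border_family A U S V) v" "S \<subseteq> topspace X"
  shows "x \<in> U v" "x \<in> A" "x \<notin> S"
  using assms closure_of_subset[of S X] by (auto simp: border_family_def)

text \<open>A point of \<open>B\<close> missed by every trace would lie in \<open>cl A\<close> and
  in all \<open>cl (A - snd \<delta> v)\<close>. By \<open>cl_INT\<close> it would lie in the
  closure of a compact subset of \<open>X\<close>, which contains no point of the remainder.\<close>

lemma trace_family_cover:
  assumes A: "closedin X A" and B: "B \<subseteq> cl A" "B \<subseteq> remainder"
    and \<delta>: "\<delta> \<in> border_covers (subtopology X A)"
  shows "trace_family A B \<delta> \<in> finite_open_covers (subtopology Z B)"
proof -
  have topA: "topspace (subtopology X A) = A"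
    using closedin_subset[OF A] by auto
  let ?K = "A \<inter> (\<Inter>v\<in>fst \<delta>. A - snd \<delta> v)"
  have "?K = A - (\<Union>v\<in>fst \<delta>. snd \<delta> v)"
    by auto
  then have "compactin X ?K"
    using \<delta> topA by (simp add: border_covers_iff compactin_subtopology)
  then have K: "cl ?K \<subseteq> e ` topspace X"
    using compactin_imp_small by (simp only: small_def)
  have clo: "closedin X (A - snd \<delta> v)" if "v \<in> fst \<delta>" for v
  proof -
    have "closedin (subtopology X A) (topspace (subtopology X A) - snd \<delta> v)"
      using \<delta> that by (intro closedin_diff closedin_topspace) (auto simp: border_covers_iff)
    then show ?thesis
      unfolding topA using A closedin_trans_full by blast
  qed
  have "finite (fst \<delta>)"
    using \<delta> by (simp add: border_covers_iff)
  then have sub: "cl A \<inter> (\<Inter>v\<in>fst \<delta>. cl (A - snd \<delta> v)) \<subseteq> cl ?K"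
    by (rule cl_INT[OF _ A clo])
  have "\<exists>v\<in>fst \<delta>. y \<notin> cl (A - snd \<delta> v)" if y: "y \<in> B" for y
  proof (rule ccontr)
    assume "\<not> ?thesis"
    then have "y \<in> cl A \<inter> (\<Inter>v\<in>fst \<delta>. cl (A - snd \<delta> v))"
      using y B by auto
    then have "y \<in> cl ?K"
      using sub by (rule rev_subsetD)
    then show False
      using K y B by blast
  qed
  note cover = this
  have "(\<Union>v\<in>fst \<delta>. snd (trace_family A B \<delta>) v) = topspace (subtopology Z B)"
  proof (intro subset_antisym subsetI)
    fix y assume "y \<in> topspace (subtopology Z B)"
    then have "y \<in> topspace Z" "y \<in> B"
      by auto
    with cover show "y \<in> (\<Union>v\<in>fst \<delta>. snd (trace_family A B \<delta>) v)"
      by (simp add: trace_family_mem_iff)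
  next
    fix y assume "y \<in> (\<Union>v\<in>fst \<delta>. snd (trace_family A B \<delta>) v)"
    then show "y \<in> topspace (subtopology Z B)"
      by (auto simp: trace_family_mem_iff)
  qed
  moreover have "openin (subtopology Z B) (snd (trace_family A B \<delta>) v)" if "v \<in> fst \<delta>" for v
    using that by (simp add: trace_family_def openin_subtopology_Int openin_diff)
  moreover have "finite (fst \<delta>)" "snd (trace_family A B \<delta>) \<in> extensional (fst \<delta>)"
    using \<delta> by (simp_all add: border_covers_iff trace_family_def)
  ultimately show ?thesis
    unfolding finite_open_covers_iff by simp
qed

text \<open>A common point of the traces lies in \<open>cl A\<close> and in a finite intersection of
  open sets of \<open>Z\<close>. That intersection therefore contains the image of a point of
  \<open>A\<close>, which is then common to the sets of \<open>\<delta>\<close>.\<close>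

lemma nerve_trace_family:
  assumes A: "A \<subseteq> topspace X" and B: "B \<subseteq> cl A"
  shows "nerve (trace_family A B \<delta>) \<subseteq> nerve \<delta>"
proof
  fix s assume "s \<in> nerve (trace_family A B \<delta>)"
  then obtain b where s: "s \<noteq> {}" "finite s" "s \<subseteq> fst \<delta>"
    and b: "\<And>v. v \<in> s \<Longrightarrow> b \<in> snd (trace_family A B \<delta>) v"
    by (rule nerveE) auto
  let ?P = "\<Inter>v\<in>s. topspace Z - cl (A - snd \<delta> v)"
  have b': "b \<in> topspace Z - cl (A - snd \<delta> v) \<and> b \<in> B" if "v \<in> s" for v
    using b[OF that] s(3) that trace_family_mem_iff by (metis DiffI subsetD)
  have "openin Z ?P"
    using s by (intro openin_INT2) auto
  moreover have "b \<in> ?P"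
    using b' by blast
  moreover have "b \<in> cl A"
    using b' s(1) B by blast
  ultimately obtain x where x: "x \<in> A" "e x \<in> ?P"
    unfolding in_closure_of by blast
  have "x \<in> snd \<delta> v" if "v \<in> s" for v
  proof (rule ccontr)
    assume "x \<notin> snd \<delta> v"
    then have "e x \<in> cl (A - snd \<delta> v)"
      using x(1) A by (intro e_in_cl) auto
    then show False
      using x(2) that by blast
  qed
  then show "s \<in> nerve \<delta>"
    by (rule nerveI[OF s])
qed

text \<open>A point of \<open>cl A\<close> that is not adherent to \<open>A - snd \<delta> v\<close>
  is adherent to the other half \<open>A \<inter> snd \<delta> v\<close>.\<close>

lemma trace_family_subset_closure:
  assumes "v \<in> fst \<delta>" "y \<in> snd (trace_family A B \<delta>) v" "B \<subseteq> cl A" "A \<inter> snd \<delta> v \<subseteq> pre W"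
  shows "y \<in> Z closure_of W"
proof -
  have "y \<in> cl A" "y \<notin> cl (A - snd \<delta> v)"
    using assms trace_family_mem_iff by blast+
  moreover have "A = (A - snd \<delta> v) \<union> (A \<inter> snd \<delta> v)"
    by blast
  ultimately have "y \<in> cl (A \<inter> snd \<delta> v)"
    using cl_Un by (metis UnE)
  moreover have "e ` (A \<inter> snd \<delta> v) \<subseteq> W"
    using assms(4) by (auto simp: pre_def)
  ultimately show ?thesis
    using closure_of_mono[of "e ` (A \<inter> snd \<delta> v)" W Z] by blast
qed

text \<open>The uncovered set is closed and lies in a union of two small sets, hence it is
  compact.\<close>

lemma border_family_cover:
  assumes "finite V" and A: "closedin X A" and U: "\<And>v. v \<in> V \<Longrightarrow> openin X (U v)"
    and S: "small S" and "small (A - (\<Union>v\<in>V. U v))"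
  shows "border_family A U S V \<in> border_covers (subtopology X A)"
proof -
  let ?F = "A - (\<Union>v\<in>V. U v - X closure_of S)"
  have open_diff: "openin X (U v - X closure_of S)" if "v \<in> V" for v
    using U[OF that] by (intro openin_diff) auto
  then have "closedin X ?F"
    using A by (intro closedin_diff openin_Union) auto
  moreover have "small ?F"
    by (rule small_subset[OF small_Un[OF assms(5) small_closure[OF S]]]) blast
  ultimately have "compactin X ?F"
    by (rule compactin_small)
  moreover have "topspace (subtopology X A) - (\<Union>v\<in>V. snd (border_family A U S V) v) = ?F"
    using closedin_subset[OF A] by (auto simp: border_family_def)
  moreover have "openin (subtopology X A) (snd (border_family A U S V) v)" if "v \<in> V" for v
    unfolding openin_subtopology using open_diff[OF that] that
    by (intro exI[of _ "U v - X closure_of S"]) (auto simp: border_family_def)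
  ultimately show ?thesis
    using assms(1) unfolding border_covers_iff
    by (auto simp: compactin_subtopology border_family_def)
qed

lemma cl_Int_pre_subset:
  assumes "S \<subseteq> A" "S \<subseteq> pre F"
  shows "cl S \<subseteq> cl A \<inter> Z closure_of F"
proof -
  have "e ` S \<subseteq> F"
    using assms(2) by (auto simp: pre_def)
  then show ?thesis
    using cl_mono[OF assms(1)] closure_of_mono[of "e ` S" F Z] by blast
qed

lemma small_complement:
  assumes "A \<subseteq> topspace X" "\<And>v. v \<in> V \<Longrightarrow> openin Z (W v)"
    and "cl A - (\<Union>v\<in>V. W v) \<subseteq> e ` topspace X"
  shows "small (A - (\<Union>v\<in>V. pre (W v)))"
proof (rule smallI)
  show "closedin Z (cl A - (\<Union>v\<in>V. W v))"
    using assms(2) by (intro closedin_diff openin_Union) auto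
  show "e ` (A - (\<Union>v\<in>V. pre (W v))) \<subseteq> cl A - (\<Union>v\<in>V. W v)"
  proof (rule image_subsetI)
    fix x assume x: "x \<in> A - (\<Union>v\<in>V. pre (W v))"
    then have "e x \<in> cl A"
      using assms(1) by (intro e_in_cl) auto
    then show "e x \<in> cl A - (\<Union>v\<in>V. W v)"
      using x assms(1) by (auto simp: pre_def)
  qed
qed (use assms in auto)

text \<open>Spreads a closed subset \<open>B\<close> of the remainder to a closed \<open>A\<close>
  in \<open>X\<close>. The last clause turns refinements of \<open>\<alpha>\<close>, over which
  liftings are found, into refinements of \<open>\<gamma>\<close> with the same projection.\<close>

lemma cover_to_border_cover:
  assumes B: "closedin (subtopology Z remainder) B" and \<gamma>: "\<gamma> \<in> finite_open_covers (subtopology Z B)"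
  obtains A \<alpha> where "closedin X A" "B \<subseteq> cl A" "\<alpha> \<in> border_covers (subtopology X A)"
    "nerve \<alpha> \<subseteq> nerve \<gamma>"
    "\<forall>\<delta> p. is_refinement_projection \<alpha> \<delta> p \<longrightarrow> is_refinement_projection \<gamma> (trace_family A B \<delta>) p"
proof -
  let ?V = "fst \<gamma>"
  have Brem: "B \<subseteq> remainder"
    using closedin_subset[OF B] by auto
  obtain C0 where C0: "closedin Z C0" "B = C0 \<inter> remainder"
    using B by (auto simp: closedin_subtopology)
  \<comment> \<open>\<open>B\<close> is closed in the remainder, so its closure in \<open>Z\<close>
    adds only points of \<open>X\<close>.\<close>
  define C where "C = Z closure_of B"
  have C: "closedin Z C" "B \<subseteq> C"
    using Brem closure_of_subset[of B Z] by (auto simp: C_def)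
  have "C \<subseteq> C0"
    unfolding C_def using C0 by (intro closure_of_minimal) auto
  then have CB: "C \<inter> remainder \<subseteq> B"
    using C0(2) by blast
  obtain W where W: "\<And>v. v \<in> ?V \<Longrightarrow> openin Z (W v)" "\<And>v. v \<in> ?V \<Longrightarrow> snd \<gamma> v = W v \<inter> B"
    using finite_open_cover_subtopology[OF \<gamma>] by blast
  have fin: "finite ?V" and cov: "B \<subseteq> (\<Union>v\<in>?V. W v)"
    using \<gamma> W(2) Brem by (auto simp: finite_open_covers_iff)
  have CX: "C \<subseteq> topspace Z"
    by (rule closedin_subset[OF C(1)])
  then have "C - (\<Union>v\<in>?V. W v) \<subseteq> e ` topspace X"
    using CB cov by blast
  from shrink[OF fin C(1) W(1) this] obtain U where
    U: "\<And>v. v \<in> ?V \<Longrightarrow> openin Z (U v)" "\<And>v. v \<in> ?V \<Longrightarrow> Z closure_of (U v) \<inter> remainder \<subseteq> W v"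
    and CU: "C - (\<Union>v\<in>?V. U v) \<subseteq> e ` topspace X"
    by blast
  \<comment> \<open>Index sets that are not simplexes of \<open>\<gamma>\<close> and must not become
    simplexes over \<open>X\<close>.\<close>
  define bad where "bad = {s. s \<subseteq> ?V \<and> s \<noteq> {} \<and> s \<notin> nerve \<gamma>}"
  have finbad: "finite bad"
    using fin by (simp add: bad_def)
  \<comment> \<open>The region to be avoided: the intersections of closures indexed by
    \<open>bad\<close>, together with all that the \<open>U v\<close> fail to cover. Within
    \<open>C\<close> it consists of points of \<open>X\<close>.\<close>
  define T where "T = (\<Union>s\<in>bad. \<Inter>v\<in>s. Z closure_of (U v)) \<union> (topspace Z - (\<Union>v\<in>?V. U v))"
  have "closedin Z (\<Inter>v\<in>s. Z closure_of (U v))" if "s \<in> bad" for s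
    using that by (intro closedin_INT) (auto simp: bad_def)
  then have T: "closedin Z T"
    unfolding T_def using U(1) finbad
    by (intro closedin_Un closedin_Union closedin_diff openin_Union) auto
  have CT: "C \<inter> T \<subseteq> e ` topspace X"
  proof
    fix y assume y: "y \<in> C \<inter> T"
    show "y \<in> e ` topspace X"
    proof (rule ccontr)
      assume n: "y \<notin> e ` topspace X"
      then have yB: "y \<in> B" "y \<in> remainder"
        using y CX CB by blast+
      have "y \<in> (\<Union>v\<in>?V. U v)"
        using n y CU by blast
      then obtain s where s: "s \<in> bad" "\<And>v. v \<in> s \<Longrightarrow> y \<in> Z closure_of (U v)"
        using y by (auto simp: T_def)
      then have "y \<in> snd \<gamma> v" if "v \<in> s" for v
        using that U(2)[of v] W(2)[of v] yB by (auto simp: bad_def)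
      then have "s \<in> nerve \<gamma>"
        using s(1) fin finite_subset by (intro nerveI[where x = y]) (auto simp: bad_def)
      then show False
        using s(1) by (simp add: bad_def)
    qed
  qed
  obtain P Q where PQ: "openin Z P" "openin Z Q" "disjnt P Q" "C - T \<subseteq> P" "T - C \<subseteq> Q"
    using separation_modulo_X[OF C(1) T CT] .
  \<comment> \<open>Staying off \<open>Q\<close> lets \<open>cl A\<close> meet \<open>T\<close> only
    in points of \<open>X\<close>, while the trace of \<open>P\<close>, an open set around
    \<open>B\<close>, is still contained in \<open>A\<close>.\<close>
  define A where "A = pre (topspace Z - Q)"
  have A: "closedin X A"
    unfolding A_def using PQ by (intro closedin_pre closedin_diff) auto
  note AX = closedin_subset[OF A]
  have "cl A \<subseteq> topspace Z - Q"
    using PQ by (intro closure_of_minimal closedin_diff) (auto simp: A_def pre_def)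
  then have AT: "cl A \<inter> T \<subseteq> e ` topspace X"
    using PQ(5) CT by blast
  have BA: "B \<subseteq> cl A"
  proof
    fix y assume "y \<in> B"
    then have "y \<in> P"
      using Brem C(2) CT PQ(4) by blast
    then have "y \<in> cl (pre P)"
      using cl_pre_dense[OF PQ(1)] by blast
    moreover have "pre P \<subseteq> A"
      using PQ(3) openin_subset[OF PQ(1)] by (auto simp: A_def pre_def disjnt_iff)
    ultimately show "y \<in> cl A"
      using cl_mono by blast
  qed
  \<comment> \<open>Small by \<open>AT\<close>; deleting it destroys the unwanted simplexes. It also
    contains the part of \<open>A\<close> missed by the \<open>U v\<close>.\<close>
  define S where "S = A \<inter> pre T"
  have S: "small S"
  proof (rule smallI[OF _ _ _ AT])
    show "e ` S \<subseteq> cl A \<inter> T"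
      using AX by (auto simp: S_def pre_def intro!: e_in_cl)
  qed (use AX T in \<open>auto simp: S_def\<close>)
  then have SX: "S \<subseteq> topspace X"
    by (simp add: small_def)
  define \<alpha> where "\<alpha> = border_family A (\<lambda>v. pre (U v)) S ?V"
  have "A - (\<Union>v\<in>?V. pre (U v)) \<subseteq> S"
    using AX e_in_Z by (auto simp: S_def T_def pre_def)
  then have "\<alpha> \<in> border_covers (subtopology X A)"
    unfolding \<alpha>_def using fin A S U(1) small_subset[OF S]
    by (intro border_family_cover openin_pre) auto
  moreover have "nerve \<alpha> \<subseteq> nerve \<gamma>"
  proof
    fix s assume "s \<in> nerve \<alpha>"
    then obtain x where s: "s \<noteq> {}" "finite s" "s \<subseteq> ?V"
      and x: "\<And>v. v \<in> s \<Longrightarrow> x \<in> snd \<alpha> v"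
      by (rule nerveE) (auto simp: \<alpha>_def)
    have x': "x \<in> pre (U v) \<and> x \<in> A \<and> x \<notin> S" if "v \<in> s" for v
      using border_family_memD[OF _ x[OF that, unfolded \<alpha>_def] SX] s(3) that by blast
    show "s \<in> nerve \<gamma>"
    proof (rule ccontr)
      assume "s \<notin> nerve \<gamma>"
      then have "s \<in> bad"
        using s by (simp add: bad_def)
      moreover have "e x \<in> Z closure_of (U v)" if "v \<in> s" for v
        using x'[OF that] closure_of_subset[OF openin_subset[OF U(1)]] s(3) that
        by (auto simp: pre_def)
      ultimately have "e x \<in> T"
        by (auto simp: T_def)
      moreover have "x \<in> A" "x \<notin> S"
        using x' s(1) by auto
      ultimately show False
        using AX by (auto simp: S_def pre_def)
    qed
  qed
  moreover have "is_refinement_projection \<gamma> (trace_family A B \<delta>) p"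
    if p: "is_refinement_projection \<alpha> \<delta> p" for \<delta> p
    unfolding is_refinement_projection_def
  proof (intro conjI ballI subsetI)
    have pV: "p \<in> fst \<delta> \<rightarrow> ?V"
      using p by (simp add: is_refinement_projection_def \<alpha>_def)
    then show "p \<in> fst (trace_family A B \<delta>) \<rightarrow> ?V"
      by simp
    fix v y assume "v \<in> fst (trace_family A B \<delta>)" and y: "y \<in> snd (trace_family A B \<delta>) v"
    then have v: "v \<in> fst \<delta>" "p v \<in> ?V"
      using pV by auto
    have "snd \<delta> v \<subseteq> snd \<alpha> (p v)"
      using p v by (simp add: is_refinement_projection_def)
    then have "A \<inter> snd \<delta> v \<subseteq> pre (U (p v))"
      using border_family_memD(1)[OF v(2) _ SX] unfolding \<alpha>_def by blast
    then have "y \<in> Z closure_of (U (p v))"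
      by (rule trace_family_subset_closure[OF v(1) y BA])
    moreover have "y \<in> B"
      using y v trace_family_mem_iff by blast
    ultimately show "y \<in> snd \<gamma> (p v)"
      using U(2)[OF v(2)] W(2)[OF v(2)] Brem by blast
  qed
  ultimately show thesis
    using that A BA by blast
qed

text \<open>Let \<open>y\<close> be in \<open>cl A\<close> but not in
  \<open>cl (A - snd \<delta> v)\<close>. If \<open>y\<close> were in the closure of the complement
  of \<open>snd \<beta> (q v)\<close>, then \<open>cl_Int\<close> would put it in the closure of a
  subset of \<open>A - snd \<delta> v\<close>.\<close>

lemma trace_family_restrict_projection:
  assumes A: "closedin X A" and B: "B \<subseteq> cl A" "B \<subseteq> remainder"
    and \<beta>: "\<beta> \<in> border_covers X" and q: "is_refinement_projection (restrict_family A \<beta>) \<delta> q"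
  shows "is_refinement_projection (restrict_family B (trace_family (topspace X) remainder \<beta>))
    (trace_family A B \<delta>) q"
  unfolding is_refinement_projection_def
proof (intro conjI ballI subsetI)
  have qV: "q \<in> fst \<delta> \<rightarrow> fst \<beta>"
    using q by (simp add: is_refinement_projection_def restrict_family_def)
  then show "q \<in> fst (trace_family A B \<delta>) \<rightarrow> fst (restrict_family B (trace_family (topspace X) remainder \<beta>))"
    by (simp add: restrict_family_def)
  fix v y assume "v \<in> fst (trace_family A B \<delta>)" and y: "y \<in> snd (trace_family A B \<delta>) v"
  then have v: "v \<in> fst \<delta>" "q v \<in> fst \<beta>"
    using qV by auto
  have y': "y \<in> B" "y \<notin> cl (A - snd \<delta> v)"
    using y v trace_family_mem_iff by blast+
  have "snd \<delta> v \<subseteq> snd (restrict_family A \<beta>) (q v)"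
    using q v by (simp add: is_refinement_projection_def)
  then have "snd \<delta> v \<subseteq> snd \<beta> (q v)"
    using v by (auto simp: restrict_family_def)
  then have "cl (A \<inter> (topspace X - snd \<beta> (q v))) \<subseteq> cl (A - snd \<delta> v)"
    by (intro cl_mono) auto
  moreover have "cl A \<inter> cl (topspace X - snd \<beta> (q v)) \<subseteq> cl (A \<inter> (topspace X - snd \<beta> (q v)))"
    using \<beta> v by (intro cl_Int A closedin_diff) (auto simp: border_covers_iff)
  ultimately have "y \<notin> cl (topspace X - snd \<beta> (q v))"
    using y' B by blast
  then have "y \<in> snd (trace_family (topspace X) remainder \<beta>) (q v)"
    using y' B v by (auto simp: trace_family_mem_iff)
  then show "y \<in> snd (restrict_family B (trace_family (topspace X) remainder \<beta>)) (q v)"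
    using y' v by (simp add: restrict_family_def)
qed

text \<open>Indices of \<open>\<delta>'\<close> code pairs: the first coordinate \<open>r\<close>
  follows \<open>\<delta>\<close>, the second coordinate \<open>q'\<close> selects a shrunk member
  of \<open>\<beta>'\<close>. Along \<open>q \<circ> r\<close> the new sets need not lie in the
  shrunk ones.\<close>

lemma border_covers_from_covers:
  fixes p q :: "nat \<Rightarrow> nat"
  assumes A: "closedin X A" and B: "B = cl A \<inter> remainder"
    and \<beta>: "\<beta> \<in> finite_open_covers (subtopology Z remainder)"
    and \<delta>: "\<delta> \<in> finite_open_covers (subtopology Z B)"
    and p: "is_refinement_projection (trace_family A B \<alpha>) \<delta> p"
    and q: "is_refinement_projection (restrict_family B \<beta>) \<delta> q"
  defines "r \<equiv> fst \<circ> prod_decode" and "q' \<equiv> snd \<circ> prod_decode"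
  shows "\<exists>\<beta>'\<in>border_covers X. \<exists>\<delta>'\<in>border_covers (subtopology X A).
    nerve \<beta>' \<subseteq> nerve \<beta> \<and> simplicial_map (nerve \<delta>') (nerve \<delta>) r \<and>
    is_refinement_projection \<alpha> \<delta>' (p \<circ> r) \<and>
    is_refinement_projection (restrict_family A \<beta>') \<delta>' q' \<and>
    contiguous (nerve \<delta>') (nerve \<beta>) q' (q \<circ> r)"
proof -
  note AX = closedin_subset[OF A]
  have clZ: "cl S \<subseteq> topspace Z" for S
    by (rule closure_of_subset_topspace)
  obtain W where W: "\<And>u. u \<in> fst \<beta> \<Longrightarrow> openin Z (W u)" "\<And>u. u \<in> fst \<beta> \<Longrightarrow> snd \<beta> u = W u \<inter> remainder"
    using finite_open_cover_subtopology[OF \<beta>] by blast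
  obtain D where D: "\<And>v. v \<in> fst \<delta> \<Longrightarrow> openin Z (D v)" "\<And>v. v \<in> fst \<delta> \<Longrightarrow> snd \<delta> v = D v \<inter> B"
    using finite_open_cover_subtopology[OF \<delta>] by blast
  have fin\<beta>: "finite (fst \<beta>)" and fin\<delta>: "finite (fst \<delta>)"
    using \<beta> \<delta> by (simp_all add: finite_open_covers_iff)
  have "(\<Union>u\<in>fst \<beta>. snd \<beta> u) = remainder"
    using \<beta> by (auto simp: finite_open_covers_iff)
  also have "(\<Union>u\<in>fst \<beta>. snd \<beta> u) = (\<Union>u\<in>fst \<beta>. W u) \<inter> remainder"
    by (simp add: W(2))
  finally have covW: "remainder \<subseteq> (\<Union>u\<in>fst \<beta>. W u)"
    by (simp only: inf.absorb_iff2)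
  have "(\<Union>v\<in>fst \<delta>. snd \<delta> v) = B"
    using \<delta> B by (auto simp: finite_open_covers_iff)
  also have "(\<Union>v\<in>fst \<delta>. snd \<delta> v) = (\<Union>v\<in>fst \<delta>. D v) \<inter> B"
    by (simp add: D(2))
  finally have covD: "B \<subseteq> (\<Union>v\<in>fst \<delta>. D v)"
    by (simp only: inf.absorb_iff2)
  have "topspace Z - (\<Union>u\<in>fst \<beta>. W u) \<subseteq> e ` topspace X"
    using covW by blast
  \<comment> \<open>On the remainder, closures of the shrunk sets stay within the given covers.
    Intersections over \<open>X\<close> with no counterpart there are therefore relatively
    compact.\<close>
  from shrink[OF fin\<beta> closedin_topspace W(1) this] obtain V where
    V: "\<And>u. u \<in> fst \<beta> \<Longrightarrow> openin Z (V u)"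
      "\<And>u. u \<in> fst \<beta> \<Longrightarrow> Z closure_of (V u) \<inter> remainder \<subseteq> W u"
    and covV: "topspace Z - (\<Union>u\<in>fst \<beta>. V u) \<subseteq> e ` topspace X"
    by blast
  have "cl A - (\<Union>v\<in>fst \<delta>. D v) \<subseteq> e ` topspace X"
    using covD B clZ[of A] by blast
  from shrink[OF fin\<delta> closedin_cl D(1) this] obtain E where
    E: "\<And>v. v \<in> fst \<delta> \<Longrightarrow> openin Z (E v)"
      "\<And>v. v \<in> fst \<delta> \<Longrightarrow> Z closure_of (E v) \<inter> remainder \<subseteq> D v"
    and covE: "cl A - (\<Union>v\<in>fst \<delta>. E v) \<subseteq> e ` topspace X"
    by blast

  define bad where "bad = {s. s \<subseteq> fst \<beta> \<and> s \<noteq> {} \<and> s \<notin> nerve \<beta>}"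
  \<comment> \<open>The intersections of the \<open>V u\<close> that correspond to no simplex of
    \<open>\<beta>\<close>; a remainder point in the closure of one of them would make its index set
    a simplex.\<close>
  define S1 where "S1 = (\<Union>s\<in>bad. topspace X \<inter> (\<Inter>u\<in>s. pre (V u)))"
  have S1: "small S1"
    unfolding S1_def
  proof (rule small_UN)
    show "finite bad"
      using fin\<beta> by (simp add: bad_def)
    fix s assume s: "s \<in> bad"
    let ?S = "topspace X \<inter> (\<Inter>u\<in>s. pre (V u))"
    have "s \<in> nerve \<beta>" if y: "y \<in> cl ?S" "y \<in> remainder" for y
    proof (rule nerveI[where x = y])
      show "s \<noteq> {}" "s \<subseteq> fst \<beta>" "finite s"
        using s fin\<beta> finite_subset by (auto simp: bad_def)
      fix u assume u: "u \<in> s"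
      then have "?S \<subseteq> pre (V u)"
        by blast
      then have "y \<in> Z closure_of (V u)"
        using cl_Int_pre_subset[of ?S "topspace X" "V u"] y(1) by blast
      moreover have "u \<in> fst \<beta>"
        using u s by (auto simp: bad_def)
      ultimately show "y \<in> snd \<beta> u"
        using V(2) W(2) y(2) by blast
    qed
    then show "small ?S"
      using s by (intro smallI') (auto simp: bad_def)
  qed
  then have S1X: "S1 \<subseteq> topspace X"
    by (simp add: small_def)
  define \<beta>' where "\<beta>' = border_family (topspace X) (\<lambda>u. pre (V u)) S1 (fst \<beta>)"
  have small1: "small (topspace X - (\<Union>u\<in>fst \<beta>. pre (V u)))"
    by (rule small_complement) (use V(1) covV dense in auto)
  then have \<beta>': "\<beta>' \<in> border_covers X"
    using border_family_cover[of "fst \<beta>" "topspace X" "\<lambda>u. pre (V u)" S1] fin\<beta> openin_pre[OF V(1)] S1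
    by (simp add: \<beta>'_def)
  have nerve\<beta>': "nerve \<beta>' \<subseteq> nerve \<beta>"
  proof
    fix s assume "s \<in> nerve \<beta>'"
    then obtain x where s: "s \<noteq> {}" "finite s" "s \<subseteq> fst \<beta>" and x: "\<And>u. u \<in> s \<Longrightarrow> x \<in> snd \<beta>' u"
      by (rule nerveE) (auto simp: \<beta>'_def)
    have x': "x \<in> pre (V u) \<and> x \<in> topspace X \<and> x \<notin> S1" if "u \<in> s" for u
      using border_family_memD[OF _ x[OF that, unfolded \<beta>'_def] S1X] s(3) that by blast
    show "s \<in> nerve \<beta>"
    proof (rule ccontr)
      assume "s \<notin> nerve \<beta>"
      then have "s \<in> bad"
        using s by (simp add: bad_def)
      then have "x \<in> S1"
        unfolding S1_def using x' s(1) by blast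
      then show False
        using x' s(1) by blast
    qed
  qed

  define J where "J = prod_encode ` (fst \<delta> \<times> fst \<beta>)"
  have finJ: "finite J"
    using fin\<delta> fin\<beta> by (simp add: J_def)
  have J: "r j \<in> fst \<delta>" "q' j \<in> fst \<beta>" if "j \<in> J" for j
    using that by (auto simp: J_def r_def q'_def)
  define F where "F = (\<lambda>j. E (r j) \<inter> V (q' j))"
  define H where "H = (\<lambda>j. snd \<delta> (r j) \<inter> snd \<beta> (q' j))"
  \<comment> \<open>On the remainder, a point of \<open>cl A\<close> adherent to \<open>F j\<close>
    is controlled by both given covers at once.\<close>
  have FH: "y \<in> H j" if "j \<in> J" "y \<in> cl A" "y \<in> Z closure_of (F j)" "y \<in> remainder" for j y
  proof -
    have "Z closure_of (F j) \<subseteq> Z closure_of (E (r j)) \<inter> Z closure_of (V (q' j))"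
      unfolding F_def by (intro Int_greatest closure_of_mono) auto
    then show ?thesis
      using that J[OF that(1)] E(2)[of "r j"] V(2)[of "q' j"] D(2)[of "r j"] W(2)[of "q' j"] B
      unfolding H_def by blast
  qed
  \<comment> \<open>A single point common to the \<open>H j\<close> witnesses simplexes of
    \<open>\<delta>\<close> and of \<open>\<beta>\<close> simultaneously. This gives both that
    \<open>r\<close> is simplicial and that \<open>q'\<close> and \<open>q \<circ> r\<close> are
    contiguous.\<close>
  define bad' where "bad' = {s. s \<subseteq> J \<and> s \<noteq> {} \<and> (\<Inter>j\<in>s. H j) = {}}"
  define S2 where "S2 = (\<Union>s\<in>bad'. A \<inter> (\<Inter>j\<in>s. pre (F j)))"
  have S2: "small S2"
    unfolding S2_def
  proof (rule small_UN)
    show "finite bad'"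
      using finJ by (simp add: bad'_def)
    fix s assume s: "s \<in> bad'"
    let ?S = "A \<inter> (\<Inter>j\<in>s. pre (F j))"
    have "y \<notin> remainder" if y: "y \<in> cl ?S" for y
    proof
      assume yr: "y \<in> remainder"
      have "y \<in> H j" if j: "j \<in> s" for j
      proof (rule FH[OF _ _ _ yr])
        show "j \<in> J"
          using j s by (auto simp: bad'_def)
        have "?S \<subseteq> pre (F j)"
          using j by blast
        then show "y \<in> cl A" "y \<in> Z closure_of (F j)"
          using cl_Int_pre_subset[of ?S A "F j"] y by blast+
      qed
      then show False
        using s by (auto simp: bad'_def)
    qed
    then show "small ?S"
      using AX by (intro smallI') auto
  qed
  \<comment> \<open>The places where \<open>E v\<close> leaves the member of \<open>\<alpha>\<close>
    chosen by \<open>p\<close>. On the remainder \<open>p\<close> leads into the traces of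
    \<open>\<alpha>\<close>, so these places are small.\<close>
  define S3 where "S3 = (\<Union>v\<in>fst \<delta>. A \<inter> pre (E v) - snd \<alpha> (p v))"
  have S3: "small S3"
    unfolding S3_def
  proof (rule small_UN[OF fin\<delta>])
    fix v assume v: "v \<in> fst \<delta>"
    let ?S = "A \<inter> pre (E v) - snd \<alpha> (p v)"
    have "y \<notin> remainder" if y: "y \<in> cl ?S" for y
    proof
      assume yr: "y \<in> remainder"
      have "y \<in> cl A" "y \<in> Z closure_of (E v)"
        using cl_Int_pre_subset[of ?S A "E v"] y by blast+
      then have "y \<in> snd \<delta> v"
        using E(2)[OF v] D(2)[OF v] yr B by blast
      then have "y \<in> snd (trace_family A B \<alpha>) (p v)" "p v \<in> fst \<alpha>"
        using p v by (auto simp: is_refinement_projection_def)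
      then have "y \<notin> cl (A - snd \<alpha> (p v))"
        using trace_family_mem_iff by blast
      moreover have "cl ?S \<subseteq> cl (A - snd \<alpha> (p v))"
        by (intro cl_mono) blast
      ultimately show False
        using y by blast
    qed
    then show "small ?S"
      using AX by (intro smallI') auto
  qed
  \<comment> \<open>\<open>S1\<close> is included because \<open>\<beta>'\<close> lacks its closure
    and \<open>\<delta>'\<close> has to refine the restriction of \<open>\<beta>'\<close>.\<close>
  define S where "S = S1 \<union> S2 \<union> S3"
  have S: "small S"
    unfolding S_def by (intro small_Un S1 S2 S3)
  then have SX: "S \<subseteq> topspace X"
    by (simp add: small_def)
  define \<delta>' where "\<delta>' = border_family A (\<lambda>j. pre (F j)) S J"
  have small2: "small (A - (\<Union>v\<in>fst \<delta>. pre (E v)))"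
    using AX E(1) covE by (rule small_complement)
  have \<delta>': "\<delta>' \<in> border_covers (subtopology X A)"
    unfolding \<delta>'_def
  proof (rule border_family_cover[OF finJ A _ S])
    show "openin X (pre (F j))" if "j \<in> J" for j
      unfolding F_def using J[OF that] E(1) V(1) by (intro openin_pre openin_Int)
    show "small (A - (\<Union>j\<in>J. pre (F j)))"
    proof (rule small_subset[OF small_Un[OF small1 small2]], rule subsetI)
      fix x assume x: "x \<in> A - (\<Union>j\<in>J. pre (F j))"
      show "x \<in> (topspace X - (\<Union>u\<in>fst \<beta>. pre (V u))) \<union> (A - (\<Union>v\<in>fst \<delta>. pre (E v)))"
      proof (rule ccontr)
        assume "\<not> ?thesis"
        then obtain u v where "u \<in> fst \<beta>" "x \<in> pre (V u)" "v \<in> fst \<delta>" "x \<in> pre (E v)"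
          using x AX by blast
        then have "prod_encode (v, u) \<in> J" "x \<in> pre (F (prod_encode (v, u)))"
          by (auto simp: J_def F_def r_def q'_def pre_def)
        then show False
          using x by blast
      qed
    qed
  qed
  have \<delta>'_mem: "x \<in> pre (F j)" "x \<in> A" "x \<notin> S" if "j \<in> J" "x \<in> snd \<delta>' j" for x j
    using border_family_memD[OF that(1) that(2)[unfolded \<delta>'_def] SX] by blast+
  have fst\<delta>': "fst \<delta>' = J"
    by (simp add: \<delta>'_def)
  have point: "\<exists>y. \<forall>j\<in>s. y \<in> H j" and sJ: "s \<noteq> {} \<and> finite s \<and> s \<subseteq> J"
    if sN: "s \<in> nerve \<delta>'" for s
  proof -
    obtain x where s: "s \<noteq> {}" "finite s" "s \<subseteq> J" and x: "\<And>j. j \<in> s \<Longrightarrow> x \<in> snd \<delta>' j"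
      using sN by (rule nerveE) (auto simp: fst\<delta>')
    then show "s \<noteq> {} \<and> finite s \<and> s \<subseteq> J"
      by blast
    have x': "x \<in> pre (F j) \<and> x \<in> A \<and> x \<notin> S" if "j \<in> s" for j
      using \<delta>'_mem[OF _ x[OF that]] s(3) that by blast
    have "s \<notin> bad'"
    proof
      assume "s \<in> bad'"
      then have "x \<in> S2"
        unfolding S2_def using x' s(1) by blast
      then show False
        using x' s(1) by (auto simp: S_def)
    qed
    then show "\<exists>y. \<forall>j\<in>s. y \<in> H j"
      using s by (auto simp: bad'_def)
  qed
  have "simplicial_map (nerve \<delta>') (nerve \<delta>) r"
    unfolding contiguous_def
  proof
    fix s assume s: "s \<in> nerve \<delta>'"
    obtain y where y: "\<And>j. j \<in> s \<Longrightarrow> y \<in> H j"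
      using point[OF s] by blast
    show "r ` s \<union> r ` s \<in> nerve \<delta>"
      by (rule nerveI[where x = y]) (use sJ[OF s] J y in \<open>auto simp: H_def\<close>)
  qed
  moreover have "contiguous (nerve \<delta>') (nerve \<beta>) q' (q \<circ> r)"
    unfolding contiguous_def
  proof
    fix s assume s: "s \<in> nerve \<delta>'"
    obtain y where y: "\<And>j. j \<in> s \<Longrightarrow> y \<in> H j"
      using point[OF s] by blast
    have qr: "q (r j) \<in> fst \<beta> \<and> y \<in> snd \<beta> (q (r j))" if "j \<in> s" for j
    proof -
      have rj: "r j \<in> fst \<delta>" and yr: "y \<in> snd \<delta> (r j)"
        using sJ[OF s] J(1) y[OF that] that by (auto simp: H_def)
      have "q (r j) \<in> fst \<beta>"
        using q rj by (auto simp: is_refinement_projection_def restrict_family_def)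
      moreover have "y \<in> snd (restrict_family B \<beta>) (q (r j))"
        using q rj yr by (auto simp: is_refinement_projection_def)
      ultimately show ?thesis
        by (simp add: restrict_family_def)
    qed
    show "q' ` s \<union> (q \<circ> r) ` s \<in> nerve \<beta>"
      by (rule nerveI[where x = y]) (use sJ[OF s] J(2) y qr in \<open>auto simp: H_def\<close>)
  qed
  moreover have "is_refinement_projection \<alpha> \<delta>' (p \<circ> r)"
    unfolding is_refinement_projection_def fst\<delta>'
  proof (intro conjI ballI subsetI)
    show "p \<circ> r \<in> J \<rightarrow> fst \<alpha>"
      using p J(1) by (auto simp: is_refinement_projection_def)
    fix j x assume j: "j \<in> J" and x: "x \<in> snd \<delta>' j"
    have "x \<in> A \<inter> pre (E (r j))" "x \<notin> S3"
      using \<delta>'_mem[OF j x] by (auto simp: F_def S_def pre_def)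
    then show "x \<in> snd \<alpha> ((p \<circ> r) j)"
      using J(1)[OF j] by (auto simp: S3_def)
  qed
  moreover have "is_refinement_projection (restrict_family A \<beta>') \<delta>' q'"
    unfolding is_refinement_projection_def fst\<delta>'
  proof (intro conjI ballI subsetI)
    show "q' \<in> J \<rightarrow> fst (restrict_family A \<beta>')"
      using J(2) by (auto simp: restrict_family_def \<beta>'_def)
    fix j x assume j: "j \<in> J" and x: "x \<in> snd \<delta>' j"
    have "x \<in> A" "x \<in> pre (V (q' j))"
      using \<delta>'_mem[OF j x] by (auto simp: F_def pre_def)
    moreover have "x \<notin> X closure_of S1"
      using x j closure_of_mono[of S1 S X] by (auto simp: \<delta>'_def border_family_def S_def)
    ultimately show "x \<in> snd (restrict_family A \<beta>') (q' j)"
      using J(2)[OF j] AX by (auto simp: restrict_family_def \<beta>'_def border_family_def)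
  qed
  ultimately show ?thesis
    using \<beta>' \<delta>' nerve\<beta>' by blast
qed

end

section \<open>Comparison of surjectivity for border and Cech cohomology\<close>

context comm_group
begin

lemma border_restriction_epi_iff:
  assumes "closedin X A"
  shows "border_restriction n X G A \<in> epi (border_cohomology n X G) (border_cohomology n (subtopology X A) G) \<longleftrightarrow>
    (\<forall>\<alpha>\<in>border_covers (subtopology X A). \<forall>z\<in>cocycles n (nerve \<alpha>) G.
      cohomology_class_lifts n G A (border_covers X) (border_covers (subtopology X A)) \<alpha> z)"
  unfolding border_restriction_def border_cohomology_def
  by (intro limit_restriction_epi_iff directed_border_covers restrict_border_covers assms)

lemma finite_cech_restriction_epi_iff:
  "finite_cech_restriction n Y G B
      \<in> epi (finite_cech_cohomology n Y G) (finite_cech_cohomology n (subtopology Y B) G) \<longleftrightarrow>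
    (\<forall>\<alpha>\<in>finite_open_covers (subtopology Y B). \<forall>z\<in>cocycles n (nerve \<alpha>) G.
      cohomology_class_lifts n G B (finite_open_covers Y) (finite_open_covers (subtopology Y B)) \<alpha> z)"
  unfolding finite_cech_restriction_def finite_cech_cohomology_def
  by (intro limit_restriction_epi_iff directed_finite_open_covers restrict_finite_open_covers)

lemma cocycle_on_subnerve:
  assumes "z \<in> cocycles n (nerve \<gamma>) G" "nerve \<alpha> \<subseteq> nerve \<gamma>"
  shows "cochain_map n (nerve \<alpha>) id z \<in> cocycles n (nerve \<alpha>) G"
  using assms by (intro cochain_map_cocycles[where K = "nerve \<gamma>"] simplicial_complex_nerve simplicial_map_id)

text \<open>The degree is fixed, while all closed subsets are treated together: one direction
  chooses an auxiliary \<open>A\<close> for each \<open>B\<close> and its cover, the other takes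
  \<open>B = cl A \<inter> remainder\<close>.\<close>

lemma restrictions_epi_iff:
  assumes "normal_compactification X Z e"
  defines "Y \<equiv> subtopology Z (topspace Z - e ` topspace X)"
  shows "(\<forall>A. closedin X A \<longrightarrow> border_restriction n X G A
        \<in> epi (border_cohomology n X G) (border_cohomology n (subtopology X A) G)) \<longleftrightarrow>
    (\<forall>B. closedin Y B \<longrightarrow> finite_cech_restriction n Y G B
        \<in> epi (finite_cech_cohomology n Y G) (finite_cech_cohomology n (subtopology Y B) G))"
    (is "?border \<longleftrightarrow> ?cech")
proof -
  interpret normal_compactification X Z e by fact
  have subY: "subtopology Y B = subtopology Z B" if "B \<subseteq> remainder" for B
    using that by (simp add: Y_def subtopology_subtopology inf.absorb2)
  show ?thesis
  proof
    assume ?border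
    show ?cech
      unfolding finite_cech_restriction_epi_iff
    proof (intro allI impI ballI)
      fix B \<gamma> z
      assume B: "closedin Y B" and \<gamma>: "\<gamma> \<in> finite_open_covers (subtopology Y B)"
        and z: "z \<in> cocycles n (nerve \<gamma>) G"
      have Brem: "B \<subseteq> remainder"
        using closedin_subset[OF B] by (auto simp: Y_def)
      obtain A \<alpha> where A: "closedin X A" and BA: "B \<subseteq> cl A"
        and \<alpha>: "\<alpha> \<in> border_covers (subtopology X A)" and sub: "nerve \<alpha> \<subseteq> nerve \<gamma>"
        and proj: "\<forall>\<delta> p. is_refinement_projection \<alpha> \<delta> p \<longrightarrow>
          is_refinement_projection \<gamma> (trace_family A B \<delta>) p"
        by (rule cover_to_border_cover[OF B[unfolded Y_def] \<gamma>[unfolded subY[OF Brem]]])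
      \<comment> \<open>The cocycle is restricted to the smaller nerve and lifted over
        \<open>X\<close>; the covers occurring in that lifting are then replaced by their
        traces.\<close>
      have "cohomology_class_lifts n G A (border_covers X) (border_covers (subtopology X A)) \<alpha>
        (cochain_map n (nerve \<alpha>) id z)"
        using \<open>?border\<close> A \<alpha> cocycle_on_subnerve[OF z sub] by (simp add: border_restriction_epi_iff)
      then show "cohomology_class_lifts n G B (finite_open_covers Y) (finite_open_covers (subtopology Y B)) \<gamma> z"
      proof (rule cohomology_class_lifts_transfer[OF _ sub z])
        fix \<beta> \<delta> p q
        assume \<beta>: "\<beta> \<in> border_covers X" and \<delta>: "\<delta> \<in> border_covers (subtopology X A)"
          and p: "is_refinement_projection \<alpha> \<delta> p"
          and q: "is_refinement_projection (restrict_family A \<beta>) \<delta> q"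
        let ?\<beta> = "trace_family (topspace X) remainder \<beta>" and ?\<delta> = "trace_family A B \<delta>"
        have "?\<beta> \<in> finite_open_covers Y"
          unfolding Y_def by (rule trace_family_cover) (use \<beta> dense in auto)
        moreover have "?\<delta> \<in> finite_open_covers (subtopology Y B)"
          unfolding subY[OF Brem] by (rule trace_family_cover[OF A BA Brem \<delta>])
        moreover have "nerve ?\<beta> \<subseteq> nerve \<beta>"
          by (rule nerve_trace_family) (use dense in auto)
        moreover have sub\<delta>: "simplicial_map (nerve ?\<delta>) (nerve \<delta>) id"
          by (intro simplicial_map_id nerve_trace_family closedin_subset A BA)
        moreover have "is_refinement_projection \<gamma> ?\<delta> (p \<circ> id)"
          unfolding comp_id using proj p by blast
        moreover have "is_refinement_projection (restrict_family B ?\<beta>) ?\<delta> q"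
          by (rule trace_family_restrict_projection[OF A BA Brem \<beta> q])
        \<comment> \<open>Traces keep the index sets, so \<open>r\<close> is the identity and
          \<open>q'\<close> is \<open>q\<close>; contiguity reduces to \<open>q\<close> being
          simplicial into the nerve of \<open>\<beta>\<close>.\<close>
        moreover have "contiguous (nerve ?\<delta>) (nerve \<beta>) q (q \<circ> id)"
        proof -
          have q1: "simplicial_map (nerve \<delta>) (nerve (restrict_family A \<beta>)) q"
            by (intro contiguous_refinement_projections q)
          have q2: "simplicial_map (nerve (restrict_family A \<beta>)) (nerve \<beta>) id"
            by (intro contiguous_refinement_projections is_refinement_projection_restrict_id)
          have "simplicial_map (nerve ?\<delta>) (nerve \<beta>) (id \<circ> q \<circ> id)"
            by (rule simplicial_map_compose[OF sub\<delta> simplicial_map_compose[OF q1 q2]])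
          then show ?thesis by simp
        qed
        ultimately show "\<exists>\<beta>'\<in>finite_open_covers Y. \<exists>\<delta>'\<in>finite_open_covers (subtopology Y B). \<exists>r q'.
            nerve \<beta>' \<subseteq> nerve \<beta> \<and> simplicial_map (nerve \<delta>') (nerve \<delta>) r \<and>
            is_refinement_projection \<gamma> \<delta>' (p \<circ> r) \<and>
            is_refinement_projection (restrict_family B \<beta>') \<delta>' q' \<and>
            contiguous (nerve \<delta>') (nerve \<beta>) q' (q \<circ> r)"
          by blast
      qed
    qed
  next
    assume ?cech
    show ?border
    proof (intro allI impI)
      fix A assume A: "closedin X A"
      define B where "B = cl A \<inter> remainder"
      have B: "closedin Y B" "B \<subseteq> remainder" "B \<subseteq> cl A"
        unfolding B_def Y_def closedin_subtopology using closedin_cl by blast+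
      show "border_restriction n X G A \<in> epi (border_cohomology n X G) (border_cohomology n (subtopology X A) G)"
        unfolding border_restriction_epi_iff[OF A]
      proof (intro ballI)
        fix \<alpha> z assume \<alpha>: "\<alpha> \<in> border_covers (subtopology X A)" and z: "z \<in> cocycles n (nerve \<alpha>) G"
        let ?\<alpha> = "trace_family A B \<alpha>"
        have sub: "nerve ?\<alpha> \<subseteq> nerve \<alpha>"
          by (intro nerve_trace_family closedin_subset A B)
        have "?\<alpha> \<in> finite_open_covers (subtopology Y B)"
          unfolding subY[OF B(2)] by (rule trace_family_cover[OF A B(3,2) \<alpha>])
        then have "cohomology_class_lifts n G B (finite_open_covers Y) (finite_open_covers (subtopology Y B)) ?\<alpha>
          (cochain_map n (nerve ?\<alpha>) id z)"
          using \<open>?cech\<close> B(1) cocycle_on_subnerve[OF z sub] by (simp add: finite_cech_restriction_epi_iff)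
        then show "cohomology_class_lifts n G A (border_covers X) (border_covers (subtopology X A)) \<alpha> z"
        proof (rule cohomology_class_lifts_transfer[OF _ sub z])
          fix \<beta> \<delta> p q
          assume \<beta>: "\<beta> \<in> finite_open_covers Y" and \<delta>: "\<delta> \<in> finite_open_covers (subtopology Y B)"
            and p: "is_refinement_projection ?\<alpha> \<delta> p"
            and q: "is_refinement_projection (restrict_family B \<beta>) \<delta> q"
          from border_covers_from_covers[OF A B_def \<beta>[unfolded Y_def] \<delta>[unfolded subY[OF B(2)]] p q]
          show "\<exists>\<beta>'\<in>border_covers X. \<exists>\<delta>'\<in>border_covers (subtopology X A). \<exists>r q'.
            nerve \<beta>' \<subseteq> nerve \<beta> \<and> simplicial_map (nerve \<delta>') (nerve \<delta>) r \<and>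
            is_refinement_projection \<alpha> \<delta>' (p \<circ> r) \<and>
            is_refinement_projection (restrict_family A \<beta>') \<delta>' q' \<and>
            contiguous (nerve \<delta>') (nerve \<beta>) q' (q \<circ> r)"
            by blast
        qed
      qed
    qed
  qed
qed

end

theorem theorem2p5:
  fixes X :: "'a topology" and G :: "('g, 'm) monoid_scheme"
  assumes "metrizable_space X" and "comm_group G"
  shows "border_small_dimension X G = small_dimension (stone_cech_remainder X) G"
  \<comment> \<open>The equivalence holds in every degree, so both infima are taken over the same
    set.\<close>
  unfolding border_small_dimension_def small_dimension_def stone_cech_remainder_def
    comm_group.restrictions_epi_iff[OF assms(2) normal_compactification_stone_cech[OF assms(1)]] ..

end
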